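(* Let $\beta\in(0,1)$ and let $S^c$ be the censored decreasing $\beta$-stable process with lifetime (hitting time of $0$) $\tau_\infty$. For every starting point $x>0$, $\tau_\infty$ is finite in expectation, with $$\mathbb E_x[\tau_\infty]=\mathbb E_x[\tau_1]\left(1-\frac{\sin(\beta\pi)}{\beta\pi}\right)^{-1}.$$
   Context: Fix $\beta\in(0,1)$. A $\beta$-stable subordinator is a (càdlàg) Lévy process $-S=\{-S_s\}_{s\ge0}$ started at $0$ with $\mathbb E[\exp\{kS_s\}]=\exp\{-sk^\beta\}$, $k,s>0$. Let $\{-S^j\}_{j\in\mathbb N}$ be i.i.d. $\beta$-stable subordinators. For a starting point $x>0$ define recursively $\tau_0=0$; $\widetilde S^1_t=x+S^1_t$; for $j\ge2$, $\widetilde S^j_t=\widetilde S^{j-1}_{\tau_{j-1}-}+S^j_{t-\tau_{j-1}}$; $\tau_j=\inf\{s>\tau_{j-1}:\widetilde S^j_s\le0\}$ for $j\in\mathbb N$; and $\tau_\infty=\lim_{j\to\infty}\tau_j$ (where $Y_{t-}$ denotes the left limit). The censored decreasing $\beta$-stable process started at $S^c_0=x$ is $S^c_t=\widetilde S^j_t$ for $\tau_{j-1}\le t<\tau_j$, $j\in\mathbb N$, and $S^c_t=\partial$ (a cemetery state) for $t\ge\tau_\infty$. $\mathbb E_x$ denotes expectation given $S^c_0=x$. It is known that $\mathbb E_x[\tau_1]=x^\beta/\Gamma(\beta+1)$. *)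

theory Defs
  imports "HOL-Probability.Probability"
begin

text \<open>
  A process is a function \<open>X :: real \<Rightarrow> 'a \<Rightarrow> real\<close> of time and sample point; only its values at
  times \<open>t \<ge> 0\<close> are meaningful.
\<close>

definition cadlag :: "(real \<Rightarrow> real) \<Rightarrow> bool" where
  "cadlag f \<longleftrightarrow>
     (\<forall>t\<ge>0. (f \<longlongrightarrow> f t) (at_right t)) \<and>
     (\<forall>t>0. \<exists>l. (f \<longlongrightarrow> l) (at_left t))"

text \<open>
  As usual, the initial value and the path regularity are required almost surely only.
  Stochastic continuity is implied by right-continuity of the paths.
\<close>

definition levy_process :: "'a measure \<Rightarrow> (real \<Rightarrow> 'a \<Rightarrow> real) \<Rightarrow> bool" where
  "levy_process M X \<longleftrightarrow>
     prob_space M \<and>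
     (\<forall>t\<ge>0. X t \<in> borel_measurable M) \<and>
     (AE \<omega> in M. X 0 \<omega> = 0) \<and>
     (\<forall>(t :: nat \<Rightarrow> real) n. 0 \<le> t 0 \<and> (\<forall>i<n. t i \<le> t (Suc i)) \<longrightarrow>
        prob_space.indep_vars M (\<lambda>_. borel) (\<lambda>i \<omega>. X (t (Suc i)) \<omega> - X (t i) \<omega>) {..<n}) \<and>
     (\<forall>s\<ge>0. \<forall>h\<ge>0. distr M borel (\<lambda>\<omega>. X (s + h) \<omega> - X s \<omega>) = distr M borel (X h)) \<and>
     (AE \<omega> in M. cadlag (\<lambda>t. X t \<omega>))"

definition stable_subordinator :: "'a measure \<Rightarrow> real \<Rightarrow> (real \<Rightarrow> 'a \<Rightarrow> real) \<Rightarrow> bool" where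
  "stable_subordinator M \<beta> X \<longleftrightarrow>
     levy_process M X \<and>
     (\<forall>k>0. \<forall>s>0. (\<integral>\<omega>. exp (- k * X s \<omega>) \<partial>M) = exp (- s * k powr \<beta>))"

text \<open>Processes are compared as random elements of the product space over the times \<open>t \<ge> 0\<close>.\<close>

definition path_space :: "(real \<Rightarrow> real) measure" where
  "path_space = (\<Pi>\<^sub>M t\<in>{0..}. borel)"

definition trajectory :: "(real \<Rightarrow> 'a \<Rightarrow> real) \<Rightarrow> 'a \<Rightarrow> real \<Rightarrow> real" where
  "trajectory X \<omega> = (\<lambda>t\<in>{0..}. X t \<omega>)"

definition iid_processes :: "'a measure \<Rightarrow> 'i set \<Rightarrow> ('i \<Rightarrow> real \<Rightarrow> 'a \<Rightarrow> real) \<Rightarrow> bool" where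
  "iid_processes M I X \<longleftrightarrow>
     prob_space.indep_vars M (\<lambda>_. path_space) (\<lambda>i. trajectory (X i)) I \<and>
     (\<forall>i\<in>I. \<forall>j\<in>I. distr M path_space (trajectory (X i)) = distr M path_space (trajectory (X j)))"

text \<open>
  The construction is pathwise: \<open>S j t\<close> is the value of the \<open>j\<close>-th driving path at time \<open>t\<close>,
  \<open>j \<ge> 1\<close>. The times take values in \<open>[0, \<infinity>]\<close>, with the convention that the infimum of the
  empty set is \<open>\<infinity>\<close>. The piece with index \<open>0\<close> is a dummy that is never used.
\<close>

function cens_piece :: "(nat \<Rightarrow> real \<Rightarrow> real) \<Rightarrow> real \<Rightarrow> nat \<Rightarrow> real \<Rightarrow> real"
  and cens_time :: "(nat \<Rightarrow> real \<Rightarrow> real) \<Rightarrow> real \<Rightarrow> nat \<Rightarrow> ennreal"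
where
  "cens_piece S x 0 = (\<lambda>t. x)"
| "cens_piece S x (Suc 0) = (\<lambda>t. x + S 1 t)"
| "cens_piece S x (Suc (Suc j)) =
     (let \<tau> = enn2real (cens_time S x (Suc j))
      in (\<lambda>t. Lim (at_left \<tau>) (cens_piece S x (Suc j)) + S (Suc (Suc j)) (t - \<tau>)))"
| "cens_time S x 0 = 0"
| "cens_time S x (Suc j) =
     Inf {ennreal s | s. cens_time S x j < ennreal s \<and> cens_piece S x (Suc j) s \<le> 0}"
  by pat_completeness auto
termination
  by (relation "Wellfounded.measure (\<lambda>p. case p of Inl (S, x, j) \<Rightarrow> 2 * j | Inr (S, x, j) \<Rightarrow> 2 * j + 1)") auto

text \<open>
  Since path regularity and monotonicity hold only almost surely, \<open>\<omega> \<mapsto> cens_time \<dots>\<close> and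
  \<open>\<omega> \<mapsto> cens_lifetime \<dots>\<close> are to be regarded as random variables on the completed probability space.
\<close>

definition cens_lifetime :: "(nat \<Rightarrow> real \<Rightarrow> real) \<Rightarrow> real \<Rightarrow> ennreal" where
  "cens_lifetime S x = lim (cens_time S x)"

text \<open>The cemetery state is \<^const>\<open>None\<close>.\<close>

definition censored_process :: "(nat \<Rightarrow> real \<Rightarrow> real) \<Rightarrow> real \<Rightarrow> real \<Rightarrow> real option" where
  "censored_process S x t =
     (if cens_lifetime S x \<le> ennreal t then None
      else Some (cens_piece S x
        (THE j. 1 \<le> j \<and> cens_time S x (j - 1) \<le> ennreal t \<and> ennreal t < cens_time S x j) t))"

lemma cens_lifetime_eq_killing_time:
  "cens_lifetime S x = Inf {ennreal t | t. 0 \<le> t \<and> censored_process S x t = None}"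
proof (cases "cens_lifetime S x")
  case (real r)
  then show ?thesis
    by (intro antisym Inf_greatest Inf_lower)
       (auto simp: censored_process_def split: if_splits)
next
  case top
  have "{ennreal t | t. 0 \<le> t \<and> censored_process S x t = None} = {}"
    using top by (auto simp: censored_process_def top_unique)
  then show ?thesis using top by (simp only: Inf_empty)
qed

lemma cens_time_Suc_ge: "cens_time S x j \<le> cens_time S x (Suc j)"
  by (auto intro!: Inf_greatest)

lemma cens_time_tendsto_lifetime: "cens_time S x \<longlonglongrightarrow> cens_lifetime S x"
proof -
  have "incseq (cens_time S x)"
    by (intro incseq_SucI cens_time_Suc_ge)
  then have "cens_time S x \<longlonglongrightarrow> (SUP j. cens_time S x j)"
    by (rule LIMSEQ_SUP)
  then show ?thesis
    unfolding cens_lifetime_def by (simp add: limI)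
qed

lemma censored_process_eq_piece:
  assumes "1 \<le> j" "cens_time S x (j - 1) \<le> ennreal t" "ennreal t < cens_time S x j"
  shows "censored_process S x t = Some (cens_piece S x j t)"
proof -
  have inc: "incseq (cens_time S x)"
    by (intro incseq_SucI cens_time_Suc_ge)
  have "cens_time S x j \<le> cens_lifetime S x"
    using incseq_le[OF inc cens_time_tendsto_lifetime] .
  then have alive: "\<not> cens_lifetime S x \<le> ennreal t"
    using assms(3) by auto
  have "(THE i. 1 \<le> i \<and> cens_time S x (i - 1) \<le> ennreal t \<and> ennreal t < cens_time S x i) = j"
  proof (rule the_equality)
    fix i assume i: "1 \<le> i \<and> cens_time S x (i - 1) \<le> ennreal t \<and> ennreal t < cens_time S x i"
    have no: False if "a < b" "ennreal t < cens_time S x a" "cens_time S x (b - 1) \<le> ennreal t"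
      for a b
    proof -
      have "cens_time S x a \<le> cens_time S x (b - 1)"
        using that(1) by (intro incseqD[OF inc]) simp
      with that(2,3) show False by (meson less_le_trans not_less)
    qed
    show "i = j"
      using no[of i j] no[of j i] i assms by (cases i j rule: linorder_cases) auto
  qed (use assms in auto)
  then show ?thesis using alive by (simp add: censored_process_def)
qed

end

theory Submission
  imports Defs "HOL-Real_Asymp.Real_Asymp"
begin

text \<open>
  Let \<open>X = -S\<close>, let \<open>T\<close> be the first passage time of \<open>X\<close> over the level \<open>y\<close>, and let
  \<open>Y(y) = y - X(T-)\<close> be the undershoot. By scaling, \<open>E[T] = C y\<^sup>\<beta>\<close>, so by independence of the
  driving processes the theorem reduces to \<open>E[Y(y)\<^sup>\<beta>] = q y\<^sup>\<beta>\<close> with \<open>q = sin(\<beta>\<pi>)/(\<beta>\<pi>)\<close> and to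
  \<open>Y(y) > 0\<close> almost surely: the expected lifetime is then a geometric series of ratio \<open>q\<close>.

  No jump measure is needed to find the law of \<open>Y(y)\<close>. Replace \<open>X(T-)\<close> by the last value below
  \<open>y\<close> on the grid of mesh \<open>h\<close>. For the grid the transform
  \<open>\<integral> exp(-y) E[exp(-\<mu>Y(y))] dy\<close> is a geometric series, and letting \<open>h\<close> tend to \<open>0\<close> gives
  \<open>(1+\<mu>) powr (\<beta>-1)\<close>. As \<open>\<mu>\<close> tends to infinity this excludes \<open>Y(y) = 0\<close>, and integrating
  \<open>1 - exp(-\<mu>Y)\<close> against \<open>\<mu> powr (-\<beta>-1)\<close> turns it into the moment of order \<open>\<beta>\<close>, with
  the constant supplied by the reflection formula for \<open>\<Gamma>\<close>.
\<close>

section \<open>Laplace transforms determine laws on the half-line\<close>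

text \<open>The weight exp(-y) is what makes the grid computable. For consecutive grid values a and
  b, the indicator that y lies in (a, b], times exp(-\<mu>(y - a)) and averaged over y, splits into
  a factor in a and a factor in b - a, so independent stationary increments yield a geometric series
  of ratio exp(-h). The price is that only an average over levels is known. Self-similarity recovers
  a single level: Y(y) is distributed like y Y(1). Laplace transforms give self-similarity for
  one-dimensional laws only, whereas the undershoot depends on the whole path; its scaling is
  therefore also derived on the grid, where each term involves just two times. The constant appears
  as 1 / (Gamma(1 + \<beta>) Gamma(1 - \<beta>)): the first factor comes from averaging y^\<beta>
  against exp(-y), the second from integrating 1 - exp(-\<mu> Y). Positivity of Y(y) also keeps the
  construction nondegenerate: every piece starts strictly above 0 and has positive duration, so its
  left limit at the end is taken inside its own life. The constant C cancels, so only its finiteness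
  enters.\<close>

lemma measure_eqI_laplace:
  fixes \<mu> \<nu> :: "real measure"
  assumes "real_distribution \<mu>" "real_distribution \<nu>"
    and "AE x in \<mu>. 0 \<le> x" "AE x in \<nu>. 0 \<le> x"
    and eq: "\<And>n::nat. 0 < n \<Longrightarrow> (\<integral>x. exp (- real n * x) \<partial>\<mu>) = (\<integral>x. exp (- real n * x) \<partial>\<nu>)"
  shows "\<mu> = \<nu>"
proof -
  \<comment> \<open>The substitution u = exp(-x) carries the half-line into [0, 1] and turns Laplace
    transforms at integers into moments, which determine integrals of continuous functions by
    Weierstrass approximation.\<close>
  define E :: "real measure \<Rightarrow> real measure" where "E m = distr m borel (\<lambda>x. exp (- x))" for m
  have E: "real_distribution (E m)" "AE u in E m. u \<in> {0..1}"
      "m = distr (E m) borel (\<lambda>u. - ln u)"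
      "\<And>n. (\<integral>u. u ^ n \<partial>E m) = (\<integral>x. exp (- real n * x) \<partial>m)"
    if m: "real_distribution m" "AE x in m. 0 \<le> x" for m
  proof -
    interpret real_distribution m by fact
    show "real_distribution (E m)" unfolding E_def by (simp add: real_distribution_distr)
    show "AE u in E m. u \<in> {0..1}"
      unfolding E_def using m(2) by (subst AE_distr_iff) auto
    show "m = distr (E m) borel (\<lambda>u. - ln u)"
      unfolding E_def by (subst distr_distr) (auto simp: comp_def distr_id2)
    show "(\<integral>u. u ^ n \<partial>E m) = (\<integral>x. exp (- real n * x) \<partial>m)" for n
      unfolding E_def by (subst integral_distr) (auto simp: exp_of_nat_mult[symmetric])
  qed
  interpret m: real_distribution "E \<mu>" using E assms by blast
  interpret n: real_distribution "E \<nu>" using E assms by blast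
  interpret \<mu>: real_distribution \<mu> by fact
  interpret \<nu>: real_distribution \<nu> by fact
  have pow: "(\<integral>u. u ^ n \<partial>E \<mu>) = (\<integral>u. u ^ n \<partial>E \<nu>)" for n
  proof (cases "n = 0")
    case False then show ?thesis unfolding E(4)[OF assms(1,3)] E(4)[OF assms(2,4)] by (intro eq) simp
  \<comment> \<open>The moment of order 0 is the total mass, which supplies the case excluded by
    \<open>0 < n\<close>.\<close>
  qed (use m.prob_space n.prob_space in simp)
  have int: "integrable N g" if "real_distribution N" "AE u in N. u \<in> {0..1}"
      "continuous_on {0..1} g" "g \<in> borel_measurable borel" for N and g :: "real \<Rightarrow> real"
  proof -
    interpret N: real_distribution N by fact
    have "bounded (g ` {0..1})"
      using that by (intro compact_imp_bounded compact_continuous_image) auto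
    then obtain B where B: "\<forall>z\<in>g ` {0..1}. norm z \<le> B"
      unfolding bounded_iff by blast
    have "AE u in N. norm (g u) \<le> B" using that(2) by eventually_elim (use B in blast)
    then show ?thesis using that(4) by (intro N.integrable_const_bound[where B=B]) auto
  qed
  have cont: "(\<integral>u. g u \<partial>E \<mu>) = (\<integral>u. g u \<partial>E \<nu>)" if g: "continuous_on UNIV g" for g :: "real \<Rightarrow> real"
  proof (rule ccontr)
    assume ne: "(\<integral>u. g u \<partial>E \<mu>) \<noteq> (\<integral>u. g u \<partial>E \<nu>)"
    define e where "e = \<bar>(\<integral>u. g u \<partial>E \<mu>) - (\<integral>u. g u \<partial>E \<nu>)\<bar> / 3"
    have e: "0 < e" using ne unfolding e_def by auto
    have gc: "continuous_on {0..1} g" using g continuous_on_subset by blast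
    obtain P where P: "real_polynomial_function P" "\<And>u. u \<in> {0..1} \<Longrightarrow> \<bar>g u - P u\<bar> < e"
      using Stone_Weierstrass_real_polynomial_function[OF _ gc e] by auto
    obtain a k where Pa: "P = (\<lambda>x. \<Sum>i\<le>k. a i * x ^ i)"
      using P(1) unfolding real_polynomial_function_iff_sum by auto
    have gm: "g \<in> borel_measurable borel" using g by (rule borel_measurable_continuous_onI)
    have Pc: "continuous_on UNIV P" unfolding Pa by (intro continuous_intros)
    then have Pm: "P \<in> borel_measurable borel" by (rule borel_measurable_continuous_onI)
    have Pc': "continuous_on {0..1} P" using Pc continuous_on_subset by blast
    have close: "\<bar>(\<integral>u. g u \<partial>N) - (\<integral>u. P u \<partial>N)\<bar> \<le> e"
      if "real_distribution N" "AE u in N. u \<in> {0..1}" for N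
    proof -
      interpret N: real_distribution N by fact
      have i: "integrable N g" "integrable N P" by (fact int[OF that gc gm], fact int[OF that Pc' Pm])
      have "\<bar>(\<integral>u. g u \<partial>N) - (\<integral>u. P u \<partial>N)\<bar> = \<bar>\<integral>u. g u - P u \<partial>N\<bar>"
        by (simp only: Bochner_Integration.integral_diff[OF i])
      also have "\<dots> \<le> (\<integral>u. \<bar>g u - P u\<bar> \<partial>N)" by (rule integral_abs_bound)
      also have "\<dots> \<le> (\<integral>u. e \<partial>N)"
      proof (rule integral_mono_AE)
        show "AE u in N. \<bar>g u - P u\<bar> \<le> e"
          using that(2) by eventually_elim (use P(2) in \<open>blast intro: less_imp_le\<close>)
      qed (use i in auto)
      also have "\<dots> = e" using N.prob_space by simp
      finally show ?thesis .
    qed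
    have Pi: "(\<integral>u. P u \<partial>N) = (\<Sum>i\<le>k. a i * (\<integral>u. u ^ i \<partial>N))"
      if "real_distribution N" "AE u in N. u \<in> {0..1}" for N
    proof -
      have "integrable N (\<lambda>u. u ^ i)" for i
        using that by (intro int) (auto intro!: continuous_intros)
      then show ?thesis unfolding Pa by simp
    qed
    have "(\<integral>u. P u \<partial>E \<mu>) = (\<integral>u. P u \<partial>E \<nu>)"
      unfolding Pi[OF E(1,2)[OF assms(1,3)]] Pi[OF E(1,2)[OF assms(2,4)]] pow ..
    then have "\<bar>(\<integral>u. g u \<partial>E \<mu>) - (\<integral>u. g u \<partial>E \<nu>)\<bar> \<le> 2 * e"
      using close[OF E(1,2)[OF assms(1,3)]] close[OF E(1,2)[OF assms(2,4)]] by linarith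
    then show False using e unfolding e_def by auto
  qed
  \<comment> \<open>Real and imaginary parts are integrals of continuous functions, so
    \<open>cont\<close> applies to them and equality of characteristic functions follows.\<close>
  have ch: "char N t = complex_of_real (\<integral>u. cos (t * u) \<partial>N) + \<i> * complex_of_real (\<integral>u. sin (t * u) \<partial>N)"
    if "real_distribution N" for N t
  proof -
    interpret N: real_distribution N by fact
    have "integrable N (\<lambda>u. cos (t * u))" "integrable N (\<lambda>u. sin (t * u))"
      by (auto intro!: N.integrable_const_bound[where B=1])
    then have "(\<integral>u. complex_of_real (cos (t * u)) + \<i> * complex_of_real (sin (t * u)) \<partial>N)
       = complex_of_real (\<integral>u. cos (t * u) \<partial>N) + \<i> * complex_of_real (\<integral>u. sin (t * u) \<partial>N)"
      by (subst Bochner_Integration.integral_add)  auto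
    moreover have "iexp (t * u) = complex_of_real (cos (t * u)) + \<i> * complex_of_real (sin (t * u))" for u
      by (simp only: exp_Euler cos_of_real sin_of_real)
    ultimately show ?thesis unfolding char_def by (simp only:)
  qed
  have "char (E \<mu>) = char (E \<nu>)"
  proof
    fix t :: real
    have "continuous_on UNIV (\<lambda>u. cos (t * u))" "continuous_on UNIV (\<lambda>u. sin (t * u))"
      by (auto intro!: continuous_intros)
    then show "char (E \<mu>) t = char (E \<nu>) t"
      by (simp add: ch[OF m.real_distribution_axioms] ch[OF n.real_distribution_axioms] cont)
  qed
  then have "E \<mu> = E \<nu>"
    by (intro Levy_uniqueness m.real_distribution_axioms n.real_distribution_axioms)
  then show ?thesis using E(3)[OF assms(1,3)] E(3)[OF assms(2,4)] by simp
qed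

section \<open>Pathwise passage and undershoot\<close>

text \<open>
  Infima over rational times are measurable functions on the product space; on right-continuous
  nondecreasing paths they agree with the infima over all times. The value \<open>\<bar>y\<bar>\<close> at times past
  the level does not affect the infimum, which is at most \<open>y - p 0\<close>.
\<close>

definition passage :: "(real \<Rightarrow> real) \<Rightarrow> real \<Rightarrow> ennreal" where
  "passage p y = (INF s\<in>\<rat> \<inter> {0<..}. if y \<le> p s then ennreal s else \<infinity>)"

definition undershoot :: "(real \<Rightarrow> real) \<Rightarrow> real \<Rightarrow> real" where
  "undershoot p y = (INF s\<in>\<rat> \<inter> {0..}. if p s < y then y - p s else \<bar>y\<bar>)"

lemma undershoot_bdd: "bdd_below ((\<lambda>s. if p s < y then y - p s else \<bar>y::real\<bar>) ` A)"
  by (intro bdd_belowI[where m=0]) auto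

lemma undershoot_nonneg: "0 \<le> undershoot p y"
  unfolding undershoot_def by (intro cINF_greatest) (auto intro!: exI[of _ 0])

lemma measurable_passage [measurable]:
  "(\<lambda>(y, p). passage p y) \<in> borel_measurable (borel \<Otimes>\<^sub>M path_space)"
proof -
  have [measurable]: "(\<lambda>x. snd x s) \<in> borel_measurable (borel \<Otimes>\<^sub>M path_space)" if "0 \<le> s" for s
    unfolding path_space_def using that
    by (intro measurable_compose[OF measurable_snd measurable_component_singleton]) auto
  show ?thesis unfolding passage_def case_prod_beta
    by (intro borel_measurable_INF countable_Int1 countable_rat) auto
qed

lemma measurable_undershoot [measurable]:
  "(\<lambda>(y, p). undershoot p y) \<in> borel_measurable (borel \<Otimes>\<^sub>M path_space)"
proof -
  have [measurable]: "(\<lambda>x. snd x s) \<in> borel_measurable (borel \<Otimes>\<^sub>M path_space)" if "0 \<le> s" for s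
    unfolding path_space_def using that
    by (intro measurable_compose[OF measurable_snd measurable_component_singleton]) auto
  show ?thesis unfolding undershoot_def case_prod_beta
    by (intro borel_measurable_cINF countable_Int1 countable_rat undershoot_bdd) auto
qed

lemma passage_trajectory: "passage (trajectory X \<omega>) y = passage (\<lambda>t. X t \<omega>) y"
  unfolding passage_def trajectory_def by (intro INF_cong) auto

lemma undershoot_trajectory: "undershoot (trajectory X \<omega>) y = undershoot (\<lambda>t. X t \<omega>) y"
  unfolding undershoot_def trajectory_def by (intro INF_cong) auto

locale subordinator_path =
  fixes p :: "real \<Rightarrow> real"
  assumes zero: "p 0 = 0"
    and mono: "0 \<le> s \<Longrightarrow> s \<le> t \<Longrightarrow> p s \<le> p t"
    and right_cont: "0 \<le> t \<Longrightarrow> (p \<longlongrightarrow> p t) (at_right t)"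
    and unbounded: "\<exists>t\<ge>0. K < p t"
begin

lemma right_cont_less:
  assumes "0 \<le> t" "p t < y"
  obtains d where "0 < d" "p (t + d) < y"
proof -
  have "\<forall>\<^sub>F s in at_right t. p s < y"
    using order_tendstoD(2)[OF right_cont[OF assms(1)] assms(2)] .
  then obtain b where b: "b > t" "\<And>s. t < s \<Longrightarrow> s < b \<Longrightarrow> p s < y"
    unfolding eventually_at_right_field by auto
  show ?thesis using b by (intro that[of "(b - t) / 2"]) (auto simp: field_simps)
qed

text \<open>Right continuity supplies a rational time after \<open>t\<close> at which the path is
  still below \<open>y\<close>; by monotonicity its term in the infimum is at most
  \<open>y - p t\<close>.\<close>

lemma undershoot_le:
  assumes "0 \<le> t" "p t < y"
  shows "undershoot p y \<le> y - p t"
proof -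
  obtain d where d: "0 < d" "p (t + d) < y" using right_cont_less assms by metis
  obtain s where s: "s \<in> \<rat>" "t < s" "s < t + d" using Rats_dense_in_real[of t "t + d"] d by auto
  have 1: "p t \<le> p s" "p s \<le> p (t + d)" using mono s assms by auto
  have "undershoot p y \<le> (if p s < y then y - p s else \<bar>y\<bar>)"
    unfolding undershoot_def using s assms by (intro cINF_lower undershoot_bdd) auto
  then show ?thesis using 1 d by auto
qed

lemma undershoot_less:
  assumes "0 < y" "undershoot p y < z"
  obtains s where "0 \<le> s" "p s < y" "y - p s < z"
proof -
  obtain s where s: "0 \<le> s" "(if p s < y then y - p s else \<bar>y\<bar>) < z"
    using cINF_less_iff[THEN iffD1, OF _ undershoot_bdd assms(2)[unfolded undershoot_def]]
    by (auto intro: exI[of _ 0])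
  show ?thesis
  proof (cases "p s < y")
    case True then show ?thesis using s that by auto
  next
    \<comment> \<open>A time past the level contributes the default \<open>\<bar>y\<bar>\<close>,
      which for positive \<open>y\<close> is the value attained at time 0, because
      \<open>p 0 = 0\<close>.\<close>
    case False then show ?thesis using s that[of 0] assms zero by auto
  qed
qed

lemma passage_eq_Inf: "passage p y = Inf {ennreal s | s. 0 < s \<and> y \<le> p s}"
proof (rule antisym)
  show "passage p y \<le> Inf {ennreal s | s. 0 < s \<and> y \<le> p s}"
  proof (intro Inf_greatest, clarify)
    fix s :: real assume s: "0 < s" "y \<le> p s"
    show "passage p y \<le> ennreal s"
    proof (rule ennreal_le_epsilon)
      fix e :: real assume "0 < e"
      then obtain r where r: "r \<in> \<rat>" "s < r" "r < s + e" using Rats_dense_in_real[of s "s + e"] by auto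
      have "y \<le> p r" using mono[of s r] s r by auto
      have "passage p y \<le> (if y \<le> p r then ennreal r else \<infinity>)"
        unfolding passage_def using r s by (intro INF_lower) auto
      also have "\<dots> \<le> ennreal (s + e)" using \<open>y \<le> p r\<close> r by (auto intro!: ennreal_leI)
      finally show "passage p y \<le> ennreal s + ennreal e" using s \<open>0 < e\<close> by simp
    qed
  qed
  show "Inf {ennreal s | s. 0 < s \<and> y \<le> p s} \<le> passage p y"
    unfolding passage_def by (intro INF_greatest) (auto intro!: Inf_lower)
qed

lemma passage_finite: "passage p y < \<infinity>"
proof -
  obtain t where t: "0 \<le> t" "y < p t" using unbounded by auto
  then have "y \<le> p (t + 1)" using mono[of t "t+1"] by auto
  then have "passage p y \<le> ennreal (t + 1)"
    unfolding passage_eq_Inf using t by (intro Inf_lower CollectI exI[of _ "t + 1"]) auto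
  then show ?thesis using ennreal_less_top order_le_less_trans by fastforce
qed

text \<open>Right continuity makes the set of times with \<open>y \<le> p t\<close> contain its
  infimum, so the equivalence is sharp at the passage time itself. Tails of the passage time thereby
  become one-time marginals of the process.\<close>

lemma less_passage_iff:
  assumes "0 \<le> t"
  shows "ennreal t < passage p y \<longleftrightarrow> p t < y"
proof
  assume "ennreal t < passage p y"
  show "p t < y"
  proof (rule ccontr)
    assume "\<not> p t < y"
    then have y: "y \<le> p s" if "t \<le> s" for s using mono[OF assms that] by simp
    have "passage p y \<le> ennreal t"
    proof (rule ennreal_le_epsilon)
      fix e :: real assume "0 < e"
      then have "passage p y \<le> ennreal (t + e)"
        unfolding passage_eq_Inf using y[of "t + e"] assms
        by (intro Inf_lower CollectI exI[of _ "t + e"]) auto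
      then show "passage p y \<le> ennreal t + ennreal e" using assms \<open>0 < e\<close> by simp
    qed
    then show False using \<open>ennreal t < passage p y\<close> by simp
  qed
next
  assume "p t < y"
  then obtain d where d: "0 < d" "p (t + d) < y" using right_cont_less assms by metis
  have "ennreal (t + d) \<le> passage p y"
    unfolding passage_eq_Inf
  proof (intro Inf_greatest, clarify)
    fix s :: real assume "0 < s" "y \<le> p s"
    then have "t + d < s" using mono[of s "t + d"] d by (cases "t + d < s") auto
    then show "ennreal (t + d) \<le> ennreal s" by (intro ennreal_leI) simp
  qed
  then show "ennreal t < passage p y"
    using d assms by (smt (verit) ennreal_less_iff order_less_le_trans)
qed

lemma passage_pos: "0 < y \<Longrightarrow> 0 < passage p y"
  using less_passage_iff[of 0 y] zero by simp

text \<open>Before the passage all values are below \<open>y\<close>, so by monotonicity the left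
  limit is their supremum, that is, \<open>y\<close> minus the infimum defining the undershoot.
  Positivity of \<open>y\<close> makes the passage time positive, so a left neighbourhood within the
  nonnegative times exists.\<close>

lemma Lim_at_passage:
  assumes "0 < y"
  shows "(p \<longlongrightarrow> y - undershoot p y) (at_left (enn2real (passage p y)))"
proof -
  define \<sigma> where "\<sigma> = enn2real (passage p y)"
  have \<sigma>: "ennreal \<sigma> = passage p y" unfolding \<sigma>_def using passage_finite by (intro ennreal_enn2real) auto
  have \<sigma>0: "0 < \<sigma>" using passage_pos[OF assms] \<sigma> by (metis ennreal_less_zero_iff)
  have iff: "t < \<sigma> \<longleftrightarrow> p t < y" if "0 \<le> t" for t
    using less_passage_iff[OF that, of y] \<sigma> that by (metis ennreal_less_iff)
  show ?thesis unfolding \<sigma>_def[symmetric]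
  proof (rule order_tendstoI)
    fix a assume "a < y - undershoot p y"
    then have "undershoot p y < y - a" by simp
    then obtain s where s: "0 \<le> s" "p s < y" "y - p s < y - a" using undershoot_less assms by metis
    then have "s < \<sigma>" using iff by simp
    have "a < p t" if "s < t" for t using mono[of s t] that s by simp
    then show "\<forall>\<^sub>F t in at_left \<sigma>. a < p t"
      using \<open>s < \<sigma>\<close> unfolding eventually_at_left_field by auto
  next
    fix a assume a: "y - undershoot p y < a"
    have "p t < a" if "0 < t" "t < \<sigma>" for t
      using undershoot_le[of t y] iff[of t] that a by simp
    then show "\<forall>\<^sub>F t in at_left \<sigma>. p t < a"
      using \<sigma>0 unfolding eventually_at_left_field by auto
  qed
qed

lemma grid_index_ex1:
  assumes "0 < h" "0 < y"
  shows "\<exists>!n::nat. p (real n * h) < y \<and> y \<le> p (real (Suc n) * h)"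
proof -
  obtain t where t: "0 \<le> t" "y < p t" using unbounded by auto
  obtain k :: nat where "t / h \<le> real k" using real_arch_simple by blast
  then have "t \<le> real k * h" using assms by (simp add: field_simps)
  then have ex: "y \<le> p (real k * h)" using mono[of t] t by fastforce
  define k0 where "k0 = (LEAST k::nat. y \<le> p (real k * h))"
  have k0: "y \<le> p (real k0 * h)" unfolding k0_def by (rule LeastI[of _ k]) (rule ex)
  have less: "p (real i * h) < y" if "i < k0" for i using not_less_Least[OF that[unfolded k0_def]] by simp
  have "k0 \<noteq> 0" using k0 zero assms by (intro notI) simp
  then obtain n where n: "k0 = Suc n" by (cases k0) auto
  show ?thesis
  proof (intro ex1I[of _ n] conjI)
    fix m assume m: "p (real m * h) < y \<and> y \<le> p (real (Suc m) * h)"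
    have "\<not> k0 \<le> m"
    proof
      assume "k0 \<le> m"
      then have "p (real k0 * h) \<le> p (real m * h)" using assms by (intro mono mult_right_mono) auto
      then show False using m k0 by auto
    qed
    moreover have "\<not> Suc m < k0" using less[of "Suc m"] m by auto
    ultimately show "m = n" using n by auto
  qed (use less n k0 in auto)
qed

text \<open>A time \<open>s\<close> whose value nearly attains the supremum below \<open>y\<close>
  has room \<open>d\<close> to its right by right continuity. Once the mesh is less than
  \<open>d\<close>, the last grid time below the level lies beyond \<open>s\<close>.\<close>

lemma grid_value_tendsto:
  fixes h :: "nat \<Rightarrow> real" and n :: "nat \<Rightarrow> nat"
  assumes "0 < y" "\<And>m. 0 < h m" "h \<longlonglongrightarrow> 0"
    and n: "\<And>m. p (real (n m) * h m) < y \<and> y \<le> p (real (Suc (n m)) * h m)"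
  shows "(\<lambda>m. y - p (real (n m) * h m)) \<longlonglongrightarrow> undershoot p y"
proof (rule order_tendstoI)
  fix a assume "a < undershoot p y"
  moreover have "undershoot p y \<le> y - p (real (n m) * h m)" for m
    using n[of m] assms(2)[of m] by (intro undershoot_le) auto
  ultimately show "\<forall>\<^sub>F m in sequentially. a < y - p (real (n m) * h m)"
    by (intro always_eventually allI) (meson less_le_trans)
next
  fix a assume "undershoot p y < a"
  then obtain s where s: "0 \<le> s" "p s < y" "y - p s < a" using undershoot_less assms by metis
  then obtain d where d: "0 < d" "p (s + d) < y" using right_cont_less by metis
  have "\<forall>\<^sub>F m in sequentially. h m < d" using assms(3) d by (intro order_tendstoD)
  then show "\<forall>\<^sub>F m in sequentially. y - p (real (n m) * h m) < a"
  proof eventually_elim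
    case (elim m)
    have "s + d < real (Suc (n m)) * h m"
    proof (rule ccontr)
      assume "\<not> ?thesis"
      then have "p (real (Suc (n m)) * h m) \<le> p (s + d)"
        using assms(2)[of m] by (intro mono) auto
      then show False using n[of m] d by simp
    qed
    then have "s < real (n m) * h m" using elim by (simp add: algebra_simps)
    then have "p s \<le> p (real (n m) * h m)" using s by (intro mono) auto
    then show ?case using s by simp
  qed
qed

end

text \<open>The value from which piece \<open>j + 1\<close> starts: for \<open>j > 0\<close>, the
  left limit of piece \<open>j\<close> at its end. Paths are numbered from 1, so \<open>p 0\<close>
  is never read.\<close>

primrec restart :: "real \<Rightarrow> (nat \<Rightarrow> real \<Rightarrow> real) \<Rightarrow> nat \<Rightarrow> real" where
  "restart x p 0 = x"
| "restart x p (Suc j) = undershoot (p (Suc j)) (restart x p j)"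

text \<open>Times and pieces go through one induction because each time is a passage of the current
  piece and the next piece starts from the left limit at that time. Shifting by the previous time
  reduces every round to a path started at 0.\<close>

lemma cens_piece_and_time_eq:
  assumes path: "\<And>j. 1 \<le> j \<Longrightarrow> subordinator_path (\<lambda>t. - S j t)"
    and pos: "\<And>j. 0 < restart x (\<lambda>j t. - S j t) j"
  shows "cens_time S x j = (\<Sum>i<j. passage (\<lambda>t. - S (Suc i) t) (restart x (\<lambda>j t. - S j t) i)) \<and>
    cens_piece S x (Suc j) = (\<lambda>t. restart x (\<lambda>j t. - S j t) j + S (Suc j) (t - enn2real (cens_time S x j)))"
proof (induction j)
  case 0 then show ?case by simp
next
  case (Suc j)
  define y where "y = restart x (\<lambda>j t. - S j t) j"
  define p where "p = (\<lambda>t. - S (Suc j) t)"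
  interpret subordinator_path p unfolding p_def using path[of "Suc j"] by simp
  define \<tau> where "\<tau> = enn2real (cens_time S x j)"
  have "cens_time S x j < \<infinity>" using Suc subordinator_path.passage_finite[OF path] by simp
  then have \<tau>: "ennreal \<tau> = cens_time S x j" "0 \<le> \<tau>" unfolding \<tau>_def by auto
  define \<sigma> where "\<sigma> = enn2real (passage p y)"
  have \<sigma>: "ennreal \<sigma> = passage p y" unfolding \<sigma>_def using passage_finite by (intro ennreal_enn2real) auto
  have \<sigma>0: "0 \<le> \<sigma>" unfolding \<sigma>_def by simp
  have y: "0 < y" using pos unfolding y_def .
  have piece: "cens_piece S x (Suc j) = (\<lambda>t. y - p (t - \<tau>))"
    using Suc unfolding y_def p_def \<tau>_def by simp
  \<comment> \<open>Being strictly later than the previous time becomes \<open>0 < s\<close> after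
    the shift, which matches the times in \<open>passage_eq_Inf\<close>.\<close>
  have set: "{ennreal s |s. cens_time S x j < ennreal s \<and> cens_piece S x (Suc j) s \<le> 0}
     = (\<lambda>u. ennreal \<tau> + u) ` {ennreal s | s. 0 < s \<and> y \<le> p s}"
    unfolding piece \<tau>(1)[symmetric]
  proof (intro set_eqI iffI; clarsimp)
    fix s assume s: "ennreal \<tau> < ennreal s" "y \<le> p (s - \<tau>)"
    then have "\<tau> < s" using \<tau>(2) by (simp add: ennreal_less_iff)
    then show "ennreal s \<in> (+) (ennreal \<tau>) ` {ennreal s |s. 0 < s \<and> y \<le> p s}"
      using s \<tau>(2) by (intro image_eqI[of _ _ "ennreal (s - \<tau>)"]) (auto simp flip: ennreal_plus)
  next
    fix s assume s: "0 < s" "y \<le> p s"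
    then show "\<exists>r. ennreal \<tau> + ennreal s = ennreal r \<and> ennreal \<tau> < ennreal r \<and> y \<le> p (r - \<tau>)"
      using \<tau>(2) by (intro exI[of _ "\<tau> + s"]) (auto simp: ennreal_less_iff)
  qed
  \<comment> \<open>Nonemptiness is required to move the infimum through the continuous monotone map
    that adds \<open>\<tau>\<close>; it holds because the passage time is finite.\<close>
  have ne: "{ennreal s | s. 0 < s \<and> y \<le> p s} \<noteq> {}"
  proof
    assume "{ennreal s | s. 0 < s \<and> y \<le> p s} = {}"
    then have "passage p y = \<infinity>" unfolding passage_eq_Inf by (simp only: Inf_empty) simp
    then show False using passage_finite[of y] by simp
  qed
  have "cens_time S x (Suc j) = Inf ((\<lambda>u. ennreal \<tau> + u) ` {ennreal s | s. 0 < s \<and> y \<le> p s})"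
    by (simp only: cens_time.simps set)
  also have "\<dots> = ennreal \<tau> + passage p y"
    unfolding passage_eq_Inf using ne
    by (intro continuous_at_Inf_mono[symmetric]) (auto simp: mono_def intro!: continuous_add)
  finally have time: "cens_time S x (Suc j) = ennreal \<tau> + passage p y" .
  then have real_time: "enn2real (cens_time S x (Suc j)) = \<tau> + \<sigma>"
    unfolding time \<sigma>[symmetric] using \<tau>(2) \<sigma>0 by (simp flip: ennreal_plus)
  have "(p \<longlongrightarrow> y - undershoot p y) (at_left \<sigma>)"
    unfolding \<sigma>_def using Lim_at_passage[OF y] .
  moreover have "filterlim (\<lambda>t. t - \<tau>) (at_left \<sigma>) (at_left (\<tau> + \<sigma>))"
    unfolding filterlim_at by (auto intro!: tendsto_eq_intros eventually_at_leftI[of "\<tau> + \<sigma> - 1"])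
  ultimately have "((\<lambda>t. p (t - \<tau>)) \<longlongrightarrow> y - undershoot p y) (at_left (\<tau> + \<sigma>))"
    by (rule filterlim_compose)
  then have "((\<lambda>t. y - p (t - \<tau>)) \<longlongrightarrow> undershoot p y) (at_left (\<tau> + \<sigma>))"
    by (auto intro!: tendsto_eq_intros)
  then have "Lim (at_left (\<tau> + \<sigma>)) (cens_piece S x (Suc j)) = undershoot p y"
    unfolding piece by (intro tendsto_Lim) auto
  moreover have "restart x (\<lambda>j t. - S j t) (Suc j) = undershoot p y" by (simp add: p_def y_def)
  ultimately have "cens_piece S x (Suc (Suc j)) =
     (\<lambda>t. restart x (\<lambda>j t. - S j t) (Suc j) + S (Suc (Suc j)) (t - enn2real (cens_time S x (Suc j))))"
    by (simp only: cens_piece.simps Let_def real_time)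
  moreover have "cens_time S x (Suc j) = (\<Sum>i<Suc j. passage (\<lambda>t. - S (Suc i) t) (restart x (\<lambda>j t. - S j t) i))"
    using Suc time \<tau> unfolding p_def y_def by simp
  ultimately show ?case by simp
qed

section \<open>Some integrals\<close>

lemma nn_integral_Ici_eq_Ioi:
  "(\<integral>\<^sup>+t. indicator {0..} t * f t \<partial>lborel) = (\<integral>\<^sup>+t. indicator {0::real<..} t * f t \<partial>lborel)"
  using AE_lborel_singleton[of 0] by (intro nn_integral_cong_AE) (auto elim!: eventually_mono simp: indicator_def)

lemma nn_integral_exp_Ioi:
  assumes "0 < c"
  shows "(\<integral>\<^sup>+t. indicator {0::real<..} t * ennreal (exp (- c * t)) \<partial>lborel) = ennreal (1 / c)"
proof -
  have "(\<integral>\<^sup>+t. ennreal (exp (- c * t)) * indicator {0..} t \<partial>lborel) = 0 - (- exp (- c * 0) / c)"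
  proof (rule nn_integral_FTC_atLeast)
    show "((\<lambda>t. - exp (- c * t) / c) has_real_derivative exp (- c * t)) (at t)" for t
      using assms by (auto intro!: derivative_eq_intros)
    show "((\<lambda>t. - exp (- c * t) / c) \<longlongrightarrow> 0) at_top" using assms by real_asymp
  qed auto
  then show ?thesis by (subst nn_integral_Ici_eq_Ioi[symmetric]) (simp add: mult.commute)
qed

lemma nn_integral_exp_Ioc:
  assumes "0 < c" "a \<le> b"
  shows "(\<integral>\<^sup>+t. indicator {a<..b} t * ennreal (exp (- c * t)) \<partial>lborel) = ennreal ((exp (- c * a) - exp (- c * b)) / c)"
proof -
  have "(\<integral>\<^sup>+t. indicator {a<..b} t * ennreal (exp (- c * t)) \<partial>lborel)
      = (\<integral>\<^sup>+t. ennreal (exp (- c * t)) * indicator {a..b} t \<partial>lborel)"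
    using AE_lborel_singleton[of a] by (intro nn_integral_cong_AE) (auto elim!: eventually_mono simp: indicator_def)
  also have "\<dots> = (- exp (- c * b) / c) - (- exp (- c * a) / c)"
  proof (rule nn_integral_FTC_Icc)
    show "((\<lambda>t. - exp (- c * t) / c) has_real_derivative exp (- c * t)) (at t)" for t
      using assms by (auto intro!: derivative_eq_intros)
  qed (use assms in auto)
  finally show ?thesis by (simp add: diff_divide_distrib)
qed

lemma nn_integral_Gamma_Ioi:
  assumes "0 < s" "0 < c"
  shows "(\<integral>\<^sup>+t. indicator {0::real<..} t * ennreal (t powr (s - 1) * exp (- c * t)) \<partial>lborel) = ennreal (Gamma s / c powr s)"
proof -
  have [measurable]: "(\<lambda>t. indicator {0<..} t * ennreal (t powr (s - 1) * exp (- c * t))) \<in> borel_measurable borel"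
    by measurable
  have G: "(\<integral>\<^sup>+t. indicator {0<..} t * ennreal (t powr (s - 1) * exp (- t)) \<partial>lborel) = ennreal (Gamma s)"
    unfolding nn_integral_Ici_eq_Ioi[symmetric] Gamma_conv_nn_integral_real[OF assms(1)]
    by (intro nn_integral_cong) (auto simp: indicator_def exp_minus field_simps)
  have "(\<integral>\<^sup>+t. indicator {0<..} t * ennreal (t powr (s - 1) * exp (- c * t)) \<partial>lborel)
     = ennreal (1 / c) * (\<integral>\<^sup>+t. indicator {0<..} (0 + 1 / c * t) * ennreal ((0 + 1 / c * t) powr (s - 1) * exp (- c * (0 + 1 / c * t))) \<partial>lborel)"
    using assms by (subst nn_integral_real_affine[where c="1 / c" and t=0]) auto
  also have "(\<integral>\<^sup>+t. indicator {0<..} (0 + 1 / c * t) * ennreal ((0 + 1 / c * t) powr (s - 1) * exp (- c * (0 + 1 / c * t))) \<partial>lborel)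
     = (\<integral>\<^sup>+t. ennreal (c powr (1 - s)) * (indicator {0<..} t * ennreal (t powr (s - 1) * exp (- t))) \<partial>lborel)"
    using assms
    by (intro nn_integral_cong)
       (auto simp: indicator_def powr_divide powr_diff zero_less_divide_iff field_simps simp flip: ennreal_mult)
  also have "\<dots> = ennreal (c powr (1 - s)) * ennreal (Gamma s)"
    by (subst nn_integral_cmult) (auto simp: G)
  finally show ?thesis using assms
    by (simp add: ennreal_mult[symmetric] Gamma_real_pos less_imp_le powr_diff)
qed

text \<open>Since \<open>(1 - exp (- m * z)) / m\<close> is the integral of
  \<open>exp (- m * u)\<close> over \<open>0 < u \<le> z\<close>, exchanging the integrals leaves a
  Gamma integral in \<open>m\<close> and then a power integral in \<open>u\<close>.\<close>

lemma nn_integral_one_minus_exp_powr: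
  assumes \<beta>: "0 < \<beta>" "\<beta> < 1" and z: "0 \<le> z"
  shows "(\<integral>\<^sup>+m. indicator {0::real<..} m * ennreal ((1 - exp (- m * z)) * m powr (- \<beta> - 1)) \<partial>lborel)
    = ennreal (Gamma (1 - \<beta>) / \<beta> * z powr \<beta>)"
proof -
  have "(\<integral>\<^sup>+m. indicator {0<..} m * ennreal ((1 - exp (- m * z)) * m powr (- \<beta> - 1)) \<partial>lborel)
     = (\<integral>\<^sup>+m. \<integral>\<^sup>+u. indicator {0<..} m * indicator {0<..z} u * ennreal (m powr (- \<beta>) * exp (- m * u)) \<partial>lborel \<partial>lborel)"
  proof (intro nn_integral_cong)
    fix m :: real
    show "indicator {0<..} m * ennreal ((1 - exp (- m * z)) * m powr (- \<beta> - 1)) =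
      (\<integral>\<^sup>+u. indicator {0<..} m * indicator {0<..z} u * ennreal (m powr (- \<beta>) * exp (- m * u)) \<partial>lborel)"
    proof (cases "0 < m")
      case True
      have "(\<integral>\<^sup>+u. indicator {0<..} m * indicator {0<..z} u * ennreal (m powr (- \<beta>) * exp (- m * u)) \<partial>lborel)
        = (\<integral>\<^sup>+u. ennreal (m powr (- \<beta>)) * (indicator {0<..z} u * ennreal (exp (- m * u))) \<partial>lborel)"
        using True by (intro nn_integral_cong) (auto simp: indicator_def ennreal_mult)
      also have "\<dots> = ennreal (m powr (- \<beta>)) * ennreal ((exp (- m * 0) - exp (- m * z)) / m)"
        using nn_integral_exp_Ioc[OF True z] by (subst nn_integral_cmult) auto
      also have "\<dots> = ennreal ((1 - exp (- m * z)) * m powr (- \<beta> - 1))"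
        using True z by (subst ennreal_mult[symmetric]) (auto simp: powr_diff field_simps)
      finally show ?thesis using True by simp
    qed simp
  qed
  also have "\<dots> = (\<integral>\<^sup>+u. \<integral>\<^sup>+m. indicator {0<..} m * indicator {0<..z} u * ennreal (m powr (- \<beta>) * exp (- m * u)) \<partial>lborel \<partial>lborel)"
    by (intro lborel_pair.Fubini'[symmetric]) (simp add: case_prod_beta)
  also have "\<dots> = (\<integral>\<^sup>+u. ennreal (Gamma (1 - \<beta>)) * ennreal (indicator {0..z} u * u powr (\<beta> - 1)) \<partial>lborel)"
  proof (intro nn_integral_cong)
    fix u :: real
    show "(\<integral>\<^sup>+m. indicator {0<..} m * indicator {0<..z} u * ennreal (m powr (- \<beta>) * exp (- m * u)) \<partial>lborel)
       = ennreal (Gamma (1 - \<beta>)) * ennreal (indicator {0..z} u * u powr (\<beta> - 1))"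
    proof (cases "0 < u \<and> u \<le> z")
      case True
      then have "(\<integral>\<^sup>+m. indicator {0<..} m * indicator {0<..z} u * ennreal (m powr (- \<beta>) * exp (- m * u)) \<partial>lborel)
        = (\<integral>\<^sup>+m. indicator {0<..} m * ennreal (m powr ((1 - \<beta>) - 1) * exp (- u * m)) \<partial>lborel)"
        by (intro nn_integral_cong) (auto simp: mult.commute)
      also have "\<dots> = ennreal (Gamma (1 - \<beta>) / u powr (1 - \<beta>))"
        using True \<beta> by (intro nn_integral_Gamma_Ioi) auto
      also have "\<dots> = ennreal (Gamma (1 - \<beta>)) * ennreal (u powr (\<beta> - 1))"
        using True \<beta> by (subst ennreal_mult[symmetric]) (auto simp: Gamma_real_pos less_imp_le powr_diff)
      finally show ?thesis using True by simp
    qed (auto simp: indicator_def)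
  qed
  also have "\<dots> = ennreal (Gamma (1 - \<beta>)) * (\<integral>\<^sup>+u. ennreal (indicator {0..z} u * u powr (\<beta> - 1)) \<partial>lborel)"
    by (subst nn_integral_cmult) auto
  also have "(\<integral>\<^sup>+u. ennreal (indicator {0..z} u * u powr (\<beta> - 1)) \<partial>lborel) = ennreal (z powr \<beta> / \<beta>)"
    using nn_integral_has_integral_lebesgue[OF _ has_integral_powr_from_0[of "\<beta> - 1" z]] \<beta> z by simp
  finally show ?thesis using \<beta> by (simp add: ennreal_mult[symmetric] Gamma_real_pos less_imp_le)
qed

lemma nn_integral_one_minus_powr_powr:
  assumes \<beta>: "0 < \<beta>" "\<beta> < 1"
  shows "(\<integral>\<^sup>+m. indicator {0::real<..} m * ennreal ((1 - (1 + m) powr (\<beta> - 1)) * m powr (- \<beta> - 1)) \<partial>lborel)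
    = ennreal (1 / \<beta>)"
proof -
  define f where "f m = (1 - (1 + m) powr (\<beta> - 1)) * m powr (- \<beta> - 1)" for m
  \<comment> \<open>The integrand is
    \<open>m powr (- \<beta> - 1) - (1 + 1/m) powr (\<beta> - 1) / m^2\<close>, with primitive
    \<open>((1 + 1/m) powr \<beta> - m powr (- \<beta>)) / \<beta>\<close>; pulling out
    \<open>m powr (- \<beta>)\<close> gives \<open>F\<close>. Both terms blow up at 0, but
    \<open>F\<close> behaves there like \<open>m powr (1 - \<beta>)\<close> and vanishes.\<close>
  define F where "F m = ((1 + m) powr \<beta> - 1) * m powr (- \<beta>) / \<beta>" for m
  have nonneg: "0 \<le> f m" if "0 < m" for m
    unfolding f_def using that \<beta> powr_mono[of "\<beta> - 1" 0 "1 + m"]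
    by (intro mult_nonneg_nonneg) auto
  have *: "(F has_real_derivative f m) (at m)" if "0 < m" for m
  proof -
    have "(F has_real_derivative (\<beta> * (1 + m) powr (\<beta> - 1) * m powr (- \<beta>) + ((1 + m) powr \<beta> - 1) * ((- \<beta>) * m powr (- \<beta> - 1))) / \<beta>) (at m)"
    proof -
      have "((\<lambda>m. (1 + m) powr \<beta>) has_real_derivative \<beta> * (1 + m) powr (\<beta> - real 1) * 1) (at m)"
        using that by (intro DERIV_fun_powr) (auto intro!: derivative_eq_intros)
      then have 1: "((\<lambda>m. (1 + m) powr \<beta> - 1) has_real_derivative \<beta> * (1 + m) powr (\<beta> - 1)) (at m)"
        using DERIV_diff[OF _ DERIV_const[of 1]] by fastforce
      have 2: "((\<lambda>m. m powr (- \<beta>)) has_real_derivative (- \<beta>) * m powr (- \<beta> - 1)) (at m)"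
        using that by (rule has_real_derivative_powr)
      show ?thesis
        unfolding F_def[abs_def] using DERIV_cdivide[OF DERIV_mult[OF 1 2], of \<beta>] by (simp only: mult_ac add_ac)
    qed
    also have "(\<beta> * (1 + m) powr (\<beta> - 1) * m powr (- \<beta>) + ((1 + m) powr \<beta> - 1) * ((- \<beta>) * m powr (- \<beta> - 1))) / \<beta>
       = (1 + m) powr (\<beta> - 1) * m powr (- \<beta>) - ((1 + m) powr \<beta> - 1) * m powr (- \<beta> - 1)"
      using \<beta> by (simp add: diff_divide_distrib mult.assoc mult.left_commute)
    also have "\<dots> = f m"
    proof -
      have "(1 + m) powr \<beta> = (1 + m) * (1 + m) powr (\<beta> - 1)" "m powr (- \<beta>) = m * m powr (- \<beta> - 1)"
        using that powr_mult_base[of "1 + m" "\<beta> - 1"] powr_mult_base[of m "- \<beta> - 1"] by simp_all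
      then show ?thesis unfolding f_def by (simp only:) (simp add: algebra_simps)
    qed
    finally show ?thesis .
  qed
  have cont: "isCont f m" if "0 < m" for m
    unfolding f_def using that by (auto intro!: continuous_intros)
  have A: "((F \<circ> real_of_ereal) \<longlongrightarrow> 0) (at_right 0)"
  proof -
    have "(F \<longlongrightarrow> 0) (at_right 0)" unfolding F_def using \<beta> by real_asymp
    then show ?thesis using ereal_tendsto_simps1(2)[of F 0 0] by (simp add: zero_ereal_def)
  qed
  have B: "((F \<circ> real_of_ereal) \<longlongrightarrow> 1 / \<beta>) (at_left \<infinity>)"
  proof -
    have "(F \<longlongrightarrow> inverse \<beta>) at_top" unfolding F_def using \<beta> by real_asymp
    then show ?thesis unfolding ereal_tendsto_simps by (simp only: inverse_eq_divide)
  qed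
  have E: "einterval 0 \<infinity> = {0<..}" by (auto simp: einterval_def)
  have i: "set_integrable lborel {0<..} f" "(LBINT m=0..\<infinity>. f m) = 1 / \<beta> - 0"
    unfolding E[symmetric]
    by (rule interval_integral_FTC_nonneg[of 0 \<infinity> F f 0 "1 / \<beta>"];
        use * cont nonneg A B in \<open>simp add: zero_ereal_def\<close>)+
  have "(\<integral>\<^sup>+m. indicator {0<..} m * ennreal (f m) \<partial>lborel) = (\<integral>\<^sup>+m. ennreal (indicator {0<..} m *\<^sub>R f m) \<partial>lborel)"
    by (intro nn_integral_cong) (auto simp: indicator_def)
  also have "\<dots> = ennreal (LINT m:{0<..}|lborel. f m)"
    unfolding set_lebesgue_integral_def
    using i(1) nonneg by (intro nn_integral_eq_integral) (auto simp: set_integrable_def indicator_def)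
  also have "(LINT m:{0<..}|lborel. f m) = 1 / \<beta>"
    using i(2) by (simp add: interval_lebesgue_integral_def E)
  finally show ?thesis by (simp add: f_def)
qed

lemma Gamma_reflection_real:
  "Gamma (1 + \<beta>) * Gamma (1 - \<beta>) = \<beta> * pi / sin (\<beta> * pi)" if "0 < \<beta>" "\<beta> < 1" for \<beta> :: real
proof -
  have 1: "1 - complex_of_real \<beta> = complex_of_real (1 - \<beta>)" by simp
  have "complex_of_real (Gamma \<beta> * Gamma (1 - \<beta>)) = complex_of_real (pi / sin (pi * \<beta>))"
    using Gamma_reflection_complex[of "of_real \<beta>"]
    unfolding 1 Gamma_complex_of_real of_real_mult[symmetric] sin_of_real of_real_divide[symmetric] .
  then have "Gamma \<beta> * Gamma (1 - \<beta>) = pi / sin (pi * \<beta>)" by (simp only: of_real_eq_iff)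
  moreover have "Gamma (1 + \<beta>) = \<beta> * Gamma \<beta>"
    using that Gamma_plus1[of \<beta>] nonpos_Ints_nonpos[of \<beta>] by (force simp: add.commute)
  ultimately show ?thesis by (simp add: mult.commute[of \<beta> pi] mult.assoc)
qed

section \<open>Stable subordinators\<close>

locale stable_subordinator_process = prob_space M for M :: "'a measure" +
  fixes X :: "real \<Rightarrow> 'a \<Rightarrow> real" and \<beta> :: real
  assumes \<beta>: "0 < \<beta>" "\<beta> < 1" and stable: "stable_subordinator M \<beta> X"
begin

definition law :: "real \<Rightarrow> real measure" where
  "law t = distr M borel (X t)"

lemma levy: "levy_process M X"
  using stable by (simp add: stable_subordinator_def)

lemma rv [measurable]: "0 \<le> t \<Longrightarrow> X t \<in> borel_measurable M"
  using levy by (simp add: levy_process_def)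

lemma start_zero: "AE \<omega> in M. X 0 \<omega> = 0"
  using levy by (simp add: levy_process_def)

lemma law_distribution: "0 \<le> t \<Longrightarrow> real_distribution (law t)"
  unfolding law_def by (simp add: real_distribution_distr)

lemma sets_law [measurable_cong, simp]: "sets (law t) = sets borel"
  by (simp add: law_def)

lemma laplace:
  assumes "0 \<le> s" "0 < k"
  shows "expectation (\<lambda>\<omega>. exp (- k * X s \<omega>)) = exp (- s * k powr \<beta>)"
    and "integrable M (\<lambda>\<omega>. exp (- k * X s \<omega>))"
proof -
  show *: "expectation (\<lambda>\<omega>. exp (- k * X s \<omega>)) = exp (- s * k powr \<beta>)"
  proof (cases "s = 0")
    case True
    have "expectation (\<lambda>\<omega>. exp (- k * X 0 \<omega>)) = expectation (\<lambda>\<omega>. 1)"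
      using start_zero by (intro integral_cong_AE) auto
    then show ?thesis using True prob_space by simp
  next
    case False
    then show ?thesis using assms stable by (simp add: stable_subordinator_def)
  qed
  \<comment> \<open>A non-integrable function has Bochner integral 0 by convention, while the value
    just found is an exponential.\<close>
  show "integrable M (\<lambda>\<omega>. exp (- k * X s \<omega>))"
  proof (rule ccontr)
    assume "\<not> ?thesis"
    from not_integrable_integral_eq[OF this] show False unfolding * by simp
  qed
qed

lemma nn_laplace:
  assumes "0 \<le> s" "0 < k"
  shows "(\<integral>\<^sup>+\<omega>. ennreal (exp (- k * X s \<omega>)) \<partial>M) = ennreal (exp (- s * k powr \<beta>))"
  using laplace[OF assms] by (subst nn_integral_eq_integral) auto

text \<open>Chernoff bound. Letting \<open>k\<close> grow gives nonnegativity; \<open>k = 1\<close>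
  gives unbounded paths and an integrable passage tail.\<close>

lemma prob_le_exp: "0 \<le> s \<Longrightarrow> 0 < k \<Longrightarrow> prob {\<omega>\<in>space M. X s \<omega> \<le> y} \<le> exp (k * y - s * k powr \<beta>)"
proof -
  assume s: "0 \<le> s" "0 < k"
  have "prob {\<omega>\<in>space M. X s \<omega> \<le> y} = expectation (indicator {\<omega>\<in>space M. X s \<omega> \<le> y})"
    by (auto intro!: arg_cong[where f=prob])
  also have "\<dots> \<le> expectation (\<lambda>\<omega>. exp (k * y) * exp (- k * X s \<omega>))"
  proof (rule integral_mono)
    show "integrable M (indicator {\<omega>\<in>space M. X s \<omega> \<le> y} :: _ \<Rightarrow> real)"
      using s by (intro integrable_real_indicator) (auto simp: emeasure_eq_measure)
    show "integrable M (\<lambda>\<omega>. exp (k * y) * exp (- k * X s \<omega>))" using laplace[OF s] by simp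
    show "indicator {\<omega>\<in>space M. X s \<omega> \<le> y} \<omega> \<le> exp (k * y) * exp (- k * X s \<omega>)" for \<omega>
      using s by (auto simp: indicator_def exp_add[symmetric])
  qed
  also have "\<dots> = exp (k * y - s * k powr \<beta>)"
    by (simp only: Bochner_Integration.integral_mult_right_zero laplace(1)[OF s]) (simp add: exp_add[symmetric])
  finally show ?thesis .
qed

text \<open>Mass below \<open>- 1 / Suc n\<close> would force the Laplace transform to grow
  exponentially in \<open>k\<close>, whereas it stays below 1.\<close>

lemma nonneg:
  assumes "0 \<le> s"
  shows "AE \<omega> in M. 0 \<le> X s \<omega>"
proof -
  have "AE \<omega> in M. - (1 / real (Suc n)) < X s \<omega>" for n
  proof -
    define p where "p = prob {\<omega>\<in>space M. X s \<omega> \<le> - (1 / real (Suc n))}"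
    have "p \<le> exp (- real k / real (Suc n))" if "1 \<le> k" for k :: nat
    proof -
      have "p \<le> exp (real k * (- (1 / real (Suc n))) - s * real k powr \<beta>)"
        unfolding p_def using that assms by (intro prob_le_exp) auto
      also have "\<dots> \<le> exp (- real k / real (Suc n))" using assms by simp
      finally show ?thesis .
    qed
    moreover have "(\<lambda>k::nat. exp (- real k / real (Suc n))) \<longlonglongrightarrow> 0" by real_asymp
    ultimately have "p \<le> 0" by (intro LIMSEQ_le_const) auto
    then have "p = 0" unfolding p_def by (simp add: measure_le_0_iff)
    then have "AE \<omega> in M. \<not> X s \<omega> \<le> - (1 / real (Suc n))"
      unfolding p_def using assms by (subst (asm) prob_eq_0) auto
    then show ?thesis by (simp add: not_le)
  qed
  then have "AE \<omega> in M. \<forall>n. - (1 / real (Suc n)) < X s \<omega>" by (simp add: AE_all_countable)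
  then show ?thesis
  proof eventually_elim
    case (elim \<omega>)
    show ?case
    proof (rule ccontr)
      assume "\<not> 0 \<le> X s \<omega>"
      then obtain n where "inverse (real (Suc n)) < - X s \<omega>" using reals_Archimedean[of "- X s \<omega>"] by auto
      then show False using elim[rule_format, of n] by (simp add: inverse_eq_divide)
    qed
  qed
qed

lemma nn_integral_law:
  "0 \<le> t \<Longrightarrow> f \<in> borel_measurable borel \<Longrightarrow> (\<integral>\<^sup>+a. f a \<partial>law t) = (\<integral>\<^sup>+\<omega>. f (X t \<omega>) \<partial>M)"
  unfolding law_def by (subst nn_integral_distr) auto

text \<open>Both sides have Laplace transform \<open>exp (- t * (k * c) powr \<beta>)\<close> in
  \<open>k\<close>. This is self-similarity at a single time, from which all later scaling is
  derived.\<close>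

lemma law_scaling:
  assumes "0 < c" "0 \<le> t"
  shows "law (c powr \<beta> * t) = distr (law t) borel (\<lambda>x. c * x)"
proof -
  have d: "distr (law t) borel (\<lambda>x. c * x) = distr M borel (\<lambda>\<omega>. c * X t \<omega>)"
    unfolding law_def using assms by (subst distr_distr) (auto simp: comp_def)
  show ?thesis unfolding d
  proof (rule measure_eqI_laplace)
    show "real_distribution (law (c powr \<beta> * t))" using assms by (intro law_distribution) auto
    show "real_distribution (distr M borel (\<lambda>\<omega>. c * X t \<omega>))"
      using assms by (intro real_distribution_distr) auto
    show "AE x in law (c powr \<beta> * t). 0 \<le> x"
      unfolding law_def using assms nonneg[of "c powr \<beta> * t"] by (subst AE_distr_iff) auto
    show "AE x in distr M borel (\<lambda>\<omega>. c * X t \<omega>). 0 \<le> x"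
      using assms nonneg[of t] by (subst AE_distr_iff) auto
    show "(\<integral>x. exp (- real n * x) \<partial>law (c powr \<beta> * t)) =
        (\<integral>x. exp (- real n * x) \<partial>distr M borel (\<lambda>\<omega>. c * X t \<omega>))" if "0 < n" for n
    proof -
      have "(\<integral>x. exp (- real n * x) \<partial>law (c powr \<beta> * t)) = exp (- (c powr \<beta> * t) * real n powr \<beta>)"
        unfolding law_def using assms that laplace(1)[of "c powr \<beta> * t" "real n"] by (subst integral_distr) auto
      moreover have "(\<integral>x. exp (- real n * x) \<partial>distr M borel (\<lambda>\<omega>. c * X t \<omega>)) = exp (- t * (real n * c) powr \<beta>)"
        using assms that laplace(1)[of t "real n * c"] by (subst integral_distr) (auto simp: mult.assoc)
      ultimately show ?thesis using assms by (simp add: powr_mult mult_ac)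
    qed
  qed
qed

lemma law_increment:
  "0 \<le> s \<Longrightarrow> 0 \<le> h \<Longrightarrow> distr M borel (\<lambda>\<omega>. X (s + h) \<omega> - X s \<omega>) = law h"
  using levy by (simp add: levy_process_def law_def)

lemma increment_nonneg:
  assumes "0 \<le> s" "s \<le> t"
  shows "AE \<omega> in M. X s \<omega> \<le> X t \<omega>"
proof -
  have "AE x in law (t - s). 0 \<le> x"
    unfolding law_def using nonneg[of "t - s"] assms by (subst AE_distr_iff) auto
  then have "AE \<omega> in M. 0 \<le> X t \<omega> - X s \<omega>"
    unfolding law_increment[of s "t - s", symmetric] using assms
    by (subst (asm) law_increment[of s "t - s", symmetric]) (auto simp: AE_distr_iff)
  then show ?thesis by simp
qed

lemma nn_integral_two_times:
  assumes s: "0 \<le> s" and h: "0 \<le> h" and f [measurable]: "(\<lambda>(a, b). f a b) \<in> borel_measurable (borel \<Otimes>\<^sub>M borel)"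
  shows "(\<integral>\<^sup>+\<omega>. f (X s \<omega>) (X (s + h) \<omega>) \<partial>M) = (\<integral>\<^sup>+a. (\<integral>\<^sup>+b. f a (a + b) \<partial>law h) \<partial>law s)"
proof -
  \<comment> \<open>The times 0, \<open>s\<close>, \<open>s + h\<close> produce two independent
    increments; as the process starts at 0 almost surely, the first is \<open>X s\<close> up to a
    null set.\<close>
  define t :: "nat \<Rightarrow> real" where "t i = (if i = 0 then 0 else if i = 1 then s else s + h)" for i
  define D where "D = (\<lambda>i \<omega>. X (t (Suc i)) \<omega> - X (t i) \<omega>)"
  have "0 \<le> t 0 \<and> (\<forall>i<2. t i \<le> t (Suc i))" using s h by (auto simp: t_def)
  then have "indep_vars (\<lambda>_. borel) D {..<2}"
    using levy unfolding levy_process_def D_def by blast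
  then have "indep_var (PiM {0} (\<lambda>_. borel)) (\<lambda>\<omega>. restrict (\<lambda>i. D i \<omega>) {0})
      (PiM {1} (\<lambda>_. borel)) (\<lambda>\<omega>. restrict (\<lambda>i. D i \<omega>) {1})"
    by (rule indep_var_restrict) auto
  then have "indep_var borel ((\<lambda>f. f 0) \<circ> (\<lambda>\<omega>. restrict (\<lambda>i. D i \<omega>) {0}))
      borel ((\<lambda>f. f 1) \<circ> (\<lambda>\<omega>. restrict (\<lambda>i. D i \<omega>) {1}))"
    by (rule indep_var_compose) auto
  then have ind: "indep_var borel (D 0) borel (D 1)" by (simp add: comp_def)
  have D0: "distr M borel (D 0) = law s" and D1: "distr M borel (D 1) = law h"
    using law_increment[of 0 s] law_increment[of s h] s h by (auto simp: D_def t_def)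
  have [measurable]: "D 0 \<in> borel_measurable M" "D (Suc 0) \<in> borel_measurable M"
    using ind by (auto dest: indep_var_rv1 indep_var_rv2)
  have joint: "law s \<Otimes>\<^sub>M law h = distr M (borel \<Otimes>\<^sub>M borel) (\<lambda>\<omega>. (D 0 \<omega>, D 1 \<omega>))"
    using ind unfolding indep_var_distribution_eq D0 D1 by simp
  interpret h: real_distribution "law h" using h by (rule law_distribution)
  have [measurable]: "(\<lambda>(a, b). f a (a + b)) \<in> borel_measurable (borel \<Otimes>\<^sub>M borel)"
    unfolding case_prod_beta by measurable
  have "(\<integral>\<^sup>+\<omega>. f (X s \<omega>) (X (s + h) \<omega>) \<partial>M) = (\<integral>\<^sup>+\<omega>. f (D 0 \<omega>) (D 0 \<omega> + D 1 \<omega>) \<partial>M)"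
    using start_zero by (intro nn_integral_cong_AE) (auto simp: D_def t_def)
  also have "\<dots> = (\<integral>\<^sup>+z. (\<lambda>(a, b). f a (a + b)) z \<partial>(law s \<Otimes>\<^sub>M law h))"
    unfolding joint by (subst nn_integral_distr) auto
  also have "\<dots> = (\<integral>\<^sup>+a. (\<integral>\<^sup>+b. f a (a + b) \<partial>law h) \<partial>law s)"
    by (subst h.nn_integral_fst[symmetric]) (auto cong: measurable_cong_sets)
  finally show ?thesis .
qed

text \<open>Each increment is nonnegative only up to its own null set, so the order is first secured
  on the countably many rational pairs and then carried to all times by right continuity.
  Unboundedness holds because all integer-time values stay below \<open>K\<close> with probability
  at most exp(K - n), for every n.\<close>

lemma AE_subordinator_path: "AE \<omega> in M. subordinator_path (\<lambda>t. X t \<omega>)"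
proof -
  have "AE \<omega> in M. \<forall>s\<in>\<rat> \<inter> {0..}. \<forall>t\<in>\<rat> \<inter> {s..}. X s \<omega> \<le> X t \<omega>"
    by (intro AE_ball_countable[THEN iffD2] ballI increment_nonneg countable_Int1 countable_rat) auto
  moreover have "AE \<omega> in M. \<forall>K::nat. \<exists>n::nat. real K < X (real n) \<omega>"
    unfolding AE_all_countable
  proof
    fix K :: nat
    define p where "p = prob {\<omega>\<in>space M. \<forall>n::nat. X (real n) \<omega> \<le> real K}"
    have "p \<le> exp (real K - real n)" for n
    proof -
      have "p \<le> prob {\<omega>\<in>space M. X (real n) \<omega> \<le> real K}"
        unfolding p_def by (intro finite_measure_mono) auto
      also have "\<dots> \<le> exp (1 * real K - real n * 1 powr \<beta>)" by (intro prob_le_exp) auto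
      finally show ?thesis by simp
    qed
    moreover have "(\<lambda>n::nat. exp (real K - real n)) \<longlonglongrightarrow> 0" by real_asymp
    ultimately have "p \<le> 0" by (intro LIMSEQ_le_const) auto
    then have "p = 0" unfolding p_def by (simp add: measure_le_0_iff)
    then have "AE \<omega> in M. \<not> (\<forall>n::nat. X (real n) \<omega> \<le> real K)"
      unfolding p_def by (subst (asm) prob_eq_0) auto
    then show "AE \<omega> in M. \<exists>n::nat. real K < X (real n) \<omega>" by (simp add: not_le)
  qed
  moreover have "AE \<omega> in M. cadlag (\<lambda>t. X t \<omega>)" using levy by (simp add: levy_process_def)
  ultimately show ?thesis using start_zero
  proof eventually_elim
    case (elim \<omega>)
    have rc: "((\<lambda>t. X t \<omega>) \<longlongrightarrow> X t \<omega>) (at_right t)" if "0 \<le> t" for t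
      using elim(3) that by (simp add: cadlag_def)
    have rat: "\<exists>r\<in>\<rat>. t < r \<and> r < b \<and> \<bar>X r \<omega> - X t \<omega>\<bar> < e"
      if t: "0 \<le> t" "t < b" and e: "0 < e" for t b e
    proof -
      have "\<forall>\<^sub>F r in at_right t. \<bar>X r \<omega> - X t \<omega>\<bar> < e"
        using tendstoD[OF rc[OF t(1)] e] by (simp add: dist_real_def)
      then obtain d where d: "t < d" and near: "\<And>r. t < r \<Longrightarrow> r < d \<Longrightarrow> \<bar>X r \<omega> - X t \<omega>\<bar> < e"
        unfolding eventually_at_right_field by auto
      obtain r where "r \<in> \<rat>" "t < r" "r < min b d"
        using Rats_dense_in_real[of t "min b d"] t(2) d by (metis min_less_iff_conj)
      then show ?thesis using near[of r] by auto
    qed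
    show ?case
    proof
      show "X s \<omega> \<le> X t \<omega>" if st: "0 \<le> s" "s \<le> t" for s t
      proof (cases "s = t")
        case False
        with st have "s < t" by simp
        show ?thesis
        proof (rule field_le_epsilon)
          fix e :: real assume "0 < e"
          \<comment> \<open>Both rationals approximate from the right, but \<open>r\<close> stays
            below \<open>t\<close>; hence \<open>r < q\<close> and the order on rationals
            applies.\<close>
          obtain r where r: "r \<in> \<rat>" "s < r" "r < t" "\<bar>X r \<omega> - X s \<omega>\<bar> < e / 2"
            using rat[of s t "e / 2"] st \<open>s < t\<close> \<open>0 < e\<close> by auto
          obtain q where q: "q \<in> \<rat>" "t < q" "\<bar>X q \<omega> - X t \<omega>\<bar> < e / 2"
            using rat[of t "t + 1" "e / 2"] st \<open>0 < e\<close> by auto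
          have "X r \<omega> \<le> X q \<omega>" using elim(1) r q st by auto
          then show "X s \<omega> \<le> X t \<omega> + e" using r(4) q(3) by linarith
        qed
      qed simp
      show "\<exists>t\<ge>0. K < X t \<omega>" for K
      proof -
        obtain k :: nat where "K \<le> real k" using real_arch_simple by blast
        moreover obtain n :: nat where "real k < X (real n) \<omega>" using elim(2) by blast
        ultimately show ?thesis by (intro exI[of _ "real n"]) auto
      qed
    qed (use elim rc in auto)
  qed
qed

end

section \<open>Mean passage time and law of the undershoot\<close>

text \<open>Layer-cake identity: the left side is the length of [0, u), also for infinite
  \<open>u\<close>.\<close>

lemma nn_integral_level_sets:
  "(\<integral>\<^sup>+t. indicator {0::real..} t * indicator {t. ennreal t < u} t \<partial>lborel) = u"
proof (cases u)
  case (real r)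
  then have "(\<integral>\<^sup>+t. indicator {0::real..} t * indicator {t. ennreal t < u} t \<partial>lborel) = (\<integral>\<^sup>+t. indicator {0..<r} t \<partial>lborel)"
    by (intro nn_integral_cong) (auto simp: indicator_def ennreal_less_iff)
  then show ?thesis using real by simp
next
  case top
  then have "(\<integral>\<^sup>+t. indicator {0::real..} t * indicator {t. ennreal t < u} t \<partial>lborel) = (\<integral>\<^sup>+t. indicator {0::real..} t \<partial>lborel)"
    by (auto intro!: nn_integral_cong simp: indicator_def)
  moreover have "emeasure lborel {0::real..} = \<infinity>"
  proof -
    have "of_nat n \<le> emeasure lborel {0::real..}" for n
      using emeasure_mono[of "{0..real n}" "{0..}" lborel] by (auto simp: ennreal_of_nat_eq_real_of_nat)
    then have "(SUP n. of_nat n) \<le> emeasure lborel {0::real..}" by (intro SUP_least)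
    then show ?thesis by (simp add: ennreal_SUP_of_nat_eq_top top_unique)
  qed
  ultimately show ?thesis using top by simp
qed

context stable_subordinator_process
begin

section \<open>Scaling and finiteness of the mean passage time\<close>

lemma measurable_passage_process [measurable]:
  "(\<lambda>\<omega>. passage (\<lambda>t. X t \<omega>) y) \<in> borel_measurable M"
  unfolding passage_def by (intro borel_measurable_INF countable_Int1 countable_rat) auto

lemma measurable_undershoot_process [measurable]:
  "(\<lambda>(y, \<omega>). undershoot (\<lambda>t. X t \<omega>) y) \<in> borel_measurable (borel \<Otimes>\<^sub>M M)"
  unfolding undershoot_def case_prod_beta
  by (intro borel_measurable_cINF countable_Int1 countable_rat undershoot_bdd) auto

lemma tail_scaling:
  assumes "0 < y" "0 \<le> t"
  shows "emeasure M {\<omega>\<in>space M. X (y powr \<beta> * t) \<omega> < y} = emeasure M {\<omega>\<in>space M. X t \<omega> < 1}"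
proof -
  have "emeasure M {\<omega>\<in>space M. X (y powr \<beta> * t) \<omega> < y} = emeasure (law (y powr \<beta> * t)) {..<y}"
    unfolding law_def using assms by (subst emeasure_distr) (auto intro!: arg_cong[where f="emeasure M"])
  also have "\<dots> = emeasure (law t) {..<1}"
  proof -
    have "(\<lambda>x. y * x) -` {..<y} = {..<1}" using assms by (auto simp: field_simps)
    then show ?thesis unfolding law_scaling[OF assms] by (subst emeasure_distr) (auto simp: law_def)
  qed
  also have "\<dots> = emeasure M {\<omega>\<in>space M. X t \<omega> < 1}"
    unfolding law_def using assms by (subst emeasure_distr) (auto intro!: arg_cong[where f="emeasure M"])
  finally show ?thesis .
qed

definition mean_passage :: ennreal where
  "mean_passage = (\<integral>\<^sup>+\<omega>. passage (\<lambda>t. X t \<omega>) 1 \<partial>M)"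

lemma passage_tail:
  "0 \<le> t \<Longrightarrow> emeasure M {\<omega>\<in>space M. ennreal t < passage (\<lambda>t. X t \<omega>) y} = emeasure M {\<omega>\<in>space M. X t \<omega> < y}"
  using AE_subordinator_path
  by (intro emeasure_eq_AE) (auto elim!: eventually_mono simp: subordinator_path.less_passage_iff)

lemma nn_integral_passage_eq_tail:
  "(\<integral>\<^sup>+\<omega>. passage (\<lambda>t. X t \<omega>) y \<partial>M) =
   (\<integral>\<^sup>+t. indicator {0..} t * emeasure M {\<omega>\<in>space M. ennreal t < passage (\<lambda>t. X t \<omega>) y} \<partial>lborel)"
  (is "_ = ?r")
proof -
  interpret L: pair_sigma_finite lborel M ..
  have "(\<integral>\<^sup>+\<omega>. passage (\<lambda>t. X t \<omega>) y \<partial>M) =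
     (\<integral>\<^sup>+\<omega>. \<integral>\<^sup>+t. indicator {0..} t * indicator {t. ennreal t < passage (\<lambda>t. X t \<omega>) y} t \<partial>lborel \<partial>M)"
    by (simp add: nn_integral_level_sets)
  also have "\<dots> = (\<integral>\<^sup>+t. \<integral>\<^sup>+\<omega>. indicator {0..} t * indicator {t. ennreal t < passage (\<lambda>t. X t \<omega>) y} t \<partial>M \<partial>lborel)"
    by (rule L.Fubini') simp
  also have "\<dots> = (\<integral>\<^sup>+t. indicator {0..} t * (\<integral>\<^sup>+\<omega>. indicator {\<omega>\<in>space M. ennreal t < passage (\<lambda>t. X t \<omega>) y} \<omega> \<partial>M) \<partial>lborel)"
    by (subst nn_integral_cmult[symmetric]) (auto intro!: nn_integral_cong simp: indicator_def)
  finally show ?thesis by simp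
qed

text \<open>Replacing the time by \<open>y powr \<beta> * t\<close> in the tail integral turns the
  tail at level \<open>y\<close> into the tail at level 1.\<close>

lemma nn_integral_passage:
  assumes y: "0 < y"
  shows "(\<integral>\<^sup>+\<omega>. passage (\<lambda>t. X t \<omega>) y \<partial>M) = ennreal (y powr \<beta>) * mean_passage"
proof -
  have [measurable]: "(\<lambda>t. emeasure M {\<omega>\<in>space M. ennreal t < passage (\<lambda>t. X t \<omega>) y}) \<in> borel_measurable borel" for y
    by measurable
  define c where "c = y powr \<beta>"
  have c: "0 < c" using y by (simp add: c_def)
  have "(\<integral>\<^sup>+\<omega>. passage (\<lambda>t. X t \<omega>) y \<partial>M) = ennreal c *
     (\<integral>\<^sup>+t. indicator {0..} (0 + c * t) * emeasure M {\<omega>\<in>space M. ennreal (0 + c * t) < passage (\<lambda>t. X t \<omega>) y} \<partial>lborel)"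
    unfolding nn_integral_passage_eq_tail using c by (subst nn_integral_real_affine[where c=c and t=0]) auto
  also have "(\<integral>\<^sup>+t. indicator {0..} (0 + c * t) * emeasure M {\<omega>\<in>space M. ennreal (0 + c * t) < passage (\<lambda>t. X t \<omega>) y} \<partial>lborel)
     = (\<integral>\<^sup>+t. indicator {0..} t * emeasure M {\<omega>\<in>space M. ennreal t < passage (\<lambda>t. X t \<omega>) 1} \<partial>lborel)"
  proof (intro nn_integral_cong)
    fix t :: real
    show "indicator {0..} (0 + c * t) * emeasure M {\<omega>\<in>space M. ennreal (0 + c * t) < passage (\<lambda>t. X t \<omega>) y}
      = indicator {0..} t * emeasure M {\<omega>\<in>space M. ennreal t < passage (\<lambda>t. X t \<omega>) 1}"
    proof (cases "0 \<le> t")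
      case True
      then show ?thesis using passage_tail[of "c * t" y] passage_tail[of t 1] tail_scaling[OF y True] c
        by (simp add: c_def)
    next
      case False
      then have "\<not> 0 \<le> c * t" using c by (simp add: zero_le_mult_iff)
      then show ?thesis using False by simp
    qed
  qed
  finally show ?thesis unfolding mean_passage_def nn_integral_passage_eq_tail c_def .
qed

text \<open>The Chernoff bound with \<open>k = 1\<close> dominates the tail at time \<open>t\<close>
  by exp(1 - t).\<close>

lemma mean_passage_finite: "mean_passage < \<infinity>"
proof -
  have "mean_passage \<le> (\<integral>\<^sup>+t. ennreal (exp 1) * (indicator {0..} t * ennreal (exp (- 1 * t))) \<partial>lborel)"
    unfolding mean_passage_def nn_integral_passage_eq_tail
  proof (intro nn_integral_mono)
    fix t :: real
    show "indicator {0..} t * emeasure M {\<omega>\<in>space M. ennreal t < passage (\<lambda>t. X t \<omega>) 1}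
       \<le> ennreal (exp 1) * (indicator {0..} t * ennreal (exp (- 1 * t)))"
    proof (cases "0 \<le> t")
      case True
      have "emeasure M {\<omega>\<in>space M. ennreal t < passage (\<lambda>t. X t \<omega>) 1} \<le> emeasure M {\<omega>\<in>space M. X t \<omega> \<le> 1}"
        unfolding passage_tail[OF True] using True by (intro emeasure_mono) auto
      also have "\<dots> \<le> ennreal (exp (1 * 1 - t * 1 powr \<beta>))"
        unfolding emeasure_eq_measure using True by (intro ennreal_leI prob_le_exp) auto
      also have "\<dots> = ennreal (exp 1) * ennreal (exp (- t))" by (simp add: ennreal_mult[symmetric] exp_diff exp_minus field_simps)
      finally show ?thesis using True by simp
    qed simp
  qed
  also have "\<dots> = ennreal (exp 1) * ennreal (1 / 1)"
    using nn_integral_exp_Ioi[of 1] by (subst nn_integral_cmult) (auto simp: nn_integral_Ici_eq_Ioi)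
  also have "\<dots> < \<infinity>" by simp
  finally show ?thesis .
qed

section \<open>Grid approximation of the undershoot\<close>

text \<open>\<open>exp (-\<mu> Y)\<close> on the event that the level \<open>y\<close> is crossed between the grid values \<open>a\<close> and \<open>b\<close>.\<close>

definition kern :: "real \<Rightarrow> real \<Rightarrow> real \<Rightarrow> real \<Rightarrow> ennreal" where
  "kern \<mu> y a b = (if a < y \<and> y \<le> b then ennreal (exp (- \<mu> * (y - a))) else 0)"

text \<open>The crossing cell is random, so all cells are summed; on a subordinator path with
  positive mesh and level exactly one summand is nonzero. The expectation thus becomes a series of
  functionals of two times.\<close>

definition grid_mean :: "real \<Rightarrow> real \<Rightarrow> real \<Rightarrow> ennreal" where
  "grid_mean h \<mu> y = (\<integral>\<^sup>+\<omega>. (\<Sum>n. kern \<mu> y (X (real n * h) \<omega>) (X (real n * h + h) \<omega>)) \<partial>M)"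

definition undershoot_laplace :: "real \<Rightarrow> real \<Rightarrow> ennreal" where
  "undershoot_laplace \<mu> y = (\<integral>\<^sup>+\<omega>. ennreal (exp (- \<mu> * undershoot (\<lambda>t. X t \<omega>) y)) \<partial>M)"

lemma measurable_kern [measurable (raw)]:
  assumes [measurable]: "f \<in> borel_measurable N" "g \<in> borel_measurable N" "k \<in> borel_measurable N" "l \<in> borel_measurable N"
  shows "(\<lambda>x. kern (f x) (g x) (k x) (l x)) \<in> borel_measurable N"
  unfolding kern_def by measurable

text \<open>\<open>law_scaling\<close> concerns single times, while an undershoot depends on the
  entire path. A grid cell involves one value and one independent increment, and each can be
  rescaled on its own.\<close>

lemma grid_mean_scaling:
  assumes c: "0 < c" and h: "0 < h"
  shows "grid_mean (c powr \<beta> * h) \<mu> (c * y) = grid_mean h (c * \<mu>) y"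
proof -
  have *: "(\<integral>\<^sup>+\<omega>. kern \<mu> (c * y) (X (real n * (c powr \<beta> * h)) \<omega>) (X (real n * (c powr \<beta> * h) + c powr \<beta> * h) \<omega>) \<partial>M)
     = (\<integral>\<^sup>+\<omega>. kern (c * \<mu>) y (X (real n * h) \<omega>) (X (real n * h + h) \<omega>) \<partial>M)" for n
  proof -
    have n: "real n * (c powr \<beta> * h) = c powr \<beta> * (real n * h)" by simp
    interpret h: real_distribution "law h" using h by (intro law_distribution) auto
    have [measurable]: "(\<lambda>a. \<integral>\<^sup>+b. kern \<mu> (c * y) a (a + c * b) \<partial>law h) \<in> borel_measurable borel"
      by (intro h.borel_measurable_nn_integral) (simp add: case_prod_beta)
    have "(\<integral>\<^sup>+\<omega>. kern \<mu> (c * y) (X (real n * (c powr \<beta> * h)) \<omega>) (X (real n * (c powr \<beta> * h) + c powr \<beta> * h) \<omega>) \<partial>M)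
       = (\<integral>\<^sup>+a. \<integral>\<^sup>+b. kern \<mu> (c * y) a (a + b) \<partial>law (c powr \<beta> * h) \<partial>law (c powr \<beta> * (real n * h)))"
      unfolding n using h by (intro nn_integral_two_times) auto
    also have "\<dots> = (\<integral>\<^sup>+a. \<integral>\<^sup>+b. kern \<mu> (c * y) (c * a) (c * a + c * b) \<partial>law h \<partial>law (real n * h))"
      using c h by (simp add: law_scaling nn_integral_distr)
    also have "\<dots> = (\<integral>\<^sup>+a. \<integral>\<^sup>+b. kern (c * \<mu>) y a (a + b) \<partial>law h \<partial>law (real n * h))"
      using c by (intro nn_integral_cong) (simp add: kern_def distrib_left[symmetric] right_diff_distrib[symmetric])
    also have "\<dots> = (\<integral>\<^sup>+\<omega>. kern (c * \<mu>) y (X (real n * h) \<omega>) (X (real n * h + h) \<omega>) \<partial>M)"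
      using h by (intro nn_integral_two_times[symmetric]) auto
    finally show ?thesis .
  qed
  have [measurable]: "X (real n * (c powr \<beta> * h)) \<in> borel_measurable M"
     "X (real n * (c powr \<beta> * h) + c powr \<beta> * h) \<in> borel_measurable M"
     "X (real n * h) \<in> borel_measurable M" "X (real n * h + h) \<in> borel_measurable M" for n
    using c h by auto
  show ?thesis unfolding grid_mean_def by (simp add: nn_integral_suminf *)
qed

lemma grid_sum:
  assumes p: "subordinator_path p" and h: "0 < h" and y: "0 < y"
    and n: "p (real n * h) < y" "y \<le> p (real (Suc n) * h)"
  shows "(\<Sum>n. kern \<mu> y (p (real n * h)) (p (real n * h + h))) = ennreal (exp (- \<mu> * (y - p (real n * h))))"
proof -
  have S: "real n * h + h = real (Suc n) * h" for n by (simp add: algebra_simps)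
  have "kern \<mu> y (p (real m * h)) (p (real m * h + h)) = 0" if "m \<noteq> n" for m
    using subordinator_path.grid_index_ex1[OF p h y] n that unfolding kern_def S by auto
  then have "(\<Sum>n. kern \<mu> y (p (real n * h)) (p (real n * h + h))) = (\<Sum>i\<in>{n}. kern \<mu> y (p (real i * h)) (p (real i * h + h)))"
    by (intro suminf_finite) auto
  then show ?thesis using n unfolding S by (simp add: kern_def)
qed

lemma grid_mean_le_1:
  assumes "0 < h" "0 < y" "0 \<le> \<mu>"
  shows "grid_mean h \<mu> y \<le> 1"
proof -
  have "grid_mean h \<mu> y \<le> (\<integral>\<^sup>+\<omega>. 1 \<partial>M)"
    unfolding grid_mean_def
  proof (rule nn_integral_mono_AE)
    show "AE \<omega> in M. (\<Sum>n. kern \<mu> y (X (real n * h) \<omega>) (X (real n * h + h) \<omega>)) \<le> 1"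
      using AE_subordinator_path
    proof eventually_elim
      case (elim \<omega>)
      then interpret subordinator_path "\<lambda>t. X t \<omega>" .
      obtain n where "X (real n * h) \<omega> < y" "y \<le> X (real (Suc n) * h) \<omega>"
        using grid_index_ex1[OF assms(1,2)] by auto
      then show ?case using assms grid_sum[OF elim assms(1,2), of n \<mu>] by simp
    qed
  qed
  then show ?thesis by (simp add: emeasure_space_1)
qed

lemma grid_mean_tendsto:
  assumes h: "\<And>m. 0 < h m" "h \<longlonglongrightarrow> 0" and y: "0 < y" and \<mu>: "0 \<le> \<mu>"
  shows "(\<lambda>m. grid_mean (h m) \<mu> y) \<longlonglongrightarrow> undershoot_laplace \<mu> y"
  unfolding grid_mean_def undershoot_laplace_def
proof (rule nn_integral_dominated_convergence[where w="\<lambda>_. 1"])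
  have [measurable]: "X (real n * h m) \<in> borel_measurable M" "X (real n * h m + h m) \<in> borel_measurable M" for n m
    using h(1)[of m] by auto
  show "(\<lambda>\<omega>. \<Sum>n. kern \<mu> y (X (real n * h m) \<omega>) (X (real n * h m + h m) \<omega>)) \<in> borel_measurable M" for m
    by measurable
  have ex: "\<exists>n. X (real n * h m) \<omega> < y \<and> y \<le> X (real (Suc n) * h m) \<omega>"
    if "subordinator_path (\<lambda>t. X t \<omega>)" for m \<omega>
    using subordinator_path.grid_index_ex1[OF that h(1) y] by blast
  show "AE \<omega> in M. (\<Sum>n. kern \<mu> y (X (real n * h m) \<omega>) (X (real n * h m + h m) \<omega>)) \<le> 1" for m
    using AE_subordinator_path
  proof eventually_elim
    case (elim \<omega>)
    obtain n where "X (real n * h m) \<omega> < y" "y \<le> X (real (Suc n) * h m) \<omega>" using ex[OF elim] by auto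
    then show ?case using \<mu> grid_sum[OF elim h(1) y, of n m \<mu>] by simp
  qed
  show "AE \<omega> in M. (\<lambda>m. \<Sum>n. kern \<mu> y (X (real n * h m) \<omega>) (X (real n * h m + h m) \<omega>))
     \<longlonglongrightarrow> ennreal (exp (- \<mu> * undershoot (\<lambda>t. X t \<omega>) y))"
    using AE_subordinator_path
  proof eventually_elim
    case (elim \<omega>)
    then interpret subordinator_path "\<lambda>t. X t \<omega>" .
    obtain n where n: "\<And>m. X (real (n m) * h m) \<omega> < y \<and> y \<le> X (real (Suc (n m)) * h m) \<omega>"
      using ex[OF elim] by metis
    have "(\<lambda>m. y - X (real (n m) * h m) \<omega>) \<longlonglongrightarrow> undershoot (\<lambda>t. X t \<omega>) y"
      by (rule grid_value_tendsto[OF y h n])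
    then have "(\<lambda>m. ennreal (exp (- \<mu> * (y - X (real (n m) * h m) \<omega>)))) \<longlonglongrightarrow> ennreal (exp (- \<mu> * undershoot (\<lambda>t. X t \<omega>) y))"
      by (intro tendsto_intros)
    moreover have "(\<Sum>n. kern \<mu> y (X (real n * h m) \<omega>) (X (real n * h m + h m) \<omega>)) = ennreal (exp (- \<mu> * (y - X (real (n m) * h m) \<omega>)))" for m
      using n[of m] by (intro grid_sum elim h y) auto
    ultimately show ?case by simp
  qed
qed (auto simp: emeasure_space_1)

text \<open>Both meshes, \<open>h m\<close> and \<open>c powr \<beta> * h m\<close>, tend to 0, so
  the exact scaling on the grid survives in the limit.\<close>

lemma undershoot_laplace_scaling:
  assumes c: "0 < c" and y: "0 < y" and \<mu>: "0 \<le> \<mu>"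
  shows "undershoot_laplace \<mu> (c * y) = undershoot_laplace (c * \<mu>) y"
proof -
  define h where "h = (\<lambda>m. inverse (real (Suc m)))"
  have h: "\<And>m. 0 < h m" "h \<longlonglongrightarrow> 0" using LIMSEQ_inverse_real_of_nat by (auto simp: h_def)
  have "(\<lambda>m. grid_mean (c powr \<beta> * h m) \<mu> (c * y)) \<longlonglongrightarrow> undershoot_laplace \<mu> (c * y)"
    using c y \<mu> h by (intro grid_mean_tendsto tendsto_mult_right_zero) auto
  moreover have "(\<lambda>m. grid_mean (h m) (c * \<mu>) y) \<longlonglongrightarrow> undershoot_laplace (c * \<mu>) y"
    using c y \<mu> h by (intro grid_mean_tendsto) auto
  ultimately show ?thesis using grid_mean_scaling[OF c h(1)] by (simp add: LIMSEQ_unique)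
qed

text \<open>On (a, b] the weight merges with the kernel into exp(\<mu> a) exp(-(1 + \<mu>) y). The
  result splits into a factor in \<open>a\<close> and one in \<open>b - a\<close>, the form in which
  independence of increments can be used.\<close>

lemma nn_integral_exp_kern:
  assumes a: "0 \<le> a" "a \<le> b" and \<mu>: "0 \<le> \<mu>"
  shows "(\<integral>\<^sup>+y. indicator {0<..} y * ennreal (exp (- y)) * kern \<mu> y a b \<partial>lborel)
    = ennreal (exp (- a)) * ennreal ((1 - exp (- (1 + \<mu>) * (b - a))) / (1 + \<mu>))"
proof -
  have "(\<integral>\<^sup>+y. indicator {0<..} y * ennreal (exp (- y)) * kern \<mu> y a b \<partial>lborel)
    = (\<integral>\<^sup>+y. ennreal (exp (\<mu> * a)) * (indicator {a<..b} y * ennreal (exp (- (1 + \<mu>) * y))) \<partial>lborel)"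
    using a by (intro nn_integral_cong)
      (auto simp: kern_def indicator_def ennreal_mult[symmetric] exp_add[symmetric] algebra_simps)
  also have "\<dots> = ennreal (exp (\<mu> * a)) * ennreal ((exp (- (1 + \<mu>) * a) - exp (- (1 + \<mu>) * b)) / (1 + \<mu>))"
    using a \<mu> nn_integral_exp_Ioc[of "1 + \<mu>" a b] by (subst nn_integral_cmult) auto
  also have "\<dots> = ennreal (exp (\<mu> * a) * ((exp (- (1 + \<mu>) * a) - exp (- (1 + \<mu>) * b)) / (1 + \<mu>)))"
    by (subst ennreal_mult') auto
  also have "exp (\<mu> * a) * ((exp (- (1 + \<mu>) * a) - exp (- (1 + \<mu>) * b)) / (1 + \<mu>))
     = exp (- a) * ((1 - exp (- (1 + \<mu>) * (b - a))) / (1 + \<mu>))"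
    by (simp add: right_diff_distrib exp_add[symmetric] algebra_simps)
  finally show ?thesis by (subst ennreal_mult'[symmetric]) auto
qed

text \<open>Cell \<open>n\<close> contributes the mean of exp(-X(nh)) times the mean factor of one
  increment. The Laplace exponent at 1 equals 1, so the first mean is exp(-h)^n and the cells form a
  geometric series.\<close>

lemma grid_mean_laplace:
  assumes h: "0 < h" and \<mu>: "0 \<le> \<mu>"
  shows "(\<integral>\<^sup>+y. indicator {0<..} y * ennreal (exp (- y)) * grid_mean h \<mu> y \<partial>lborel)
    = ennreal ((1 - exp (- h * (1 + \<mu>) powr \<beta>)) / ((1 + \<mu>) * (1 - exp (- h))))"
proof -
  interpret L: pair_sigma_finite lborel M ..
  have [measurable]: "X (real n * h) \<in> borel_measurable M" "X (real n * h + h) \<in> borel_measurable M" for n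
    using h by auto
  \<comment> \<open>The mean of the increment factor over one mesh step, the same in every cell by
    stationarity.\<close>
  define k where "k = (1 - exp (- h * (1 + \<mu>) powr \<beta>)) / (1 + \<mu>)"
  have k: "0 \<le> k" using h \<mu> by (auto simp: k_def)
  interpret h: real_distribution "law h" using h by (intro law_distribution) auto
  have jump: "(\<integral>\<^sup>+b. ennreal ((1 - exp (- (1 + \<mu>) * b)) / (1 + \<mu>)) \<partial>law h) = ennreal k"
  proof -
    have "integrable M (\<lambda>\<omega>. exp (- (1 + \<mu>) * X h \<omega>))" using h \<mu> by (intro laplace) auto
    moreover have "AE \<omega> in M. 0 \<le> (1 - exp (- (1 + \<mu>) * X h \<omega>)) / (1 + \<mu>)"
      using nonneg[of h] h \<mu> by (auto elim!: eventually_mono intro!: divide_nonneg_nonneg mult_nonpos_nonneg)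
    ultimately have "(\<integral>\<^sup>+\<omega>. ennreal ((1 - exp (- (1 + \<mu>) * X h \<omega>)) / (1 + \<mu>)) \<partial>M) =
      ennreal (expectation (\<lambda>\<omega>. (1 - exp (- (1 + \<mu>) * X h \<omega>)) / (1 + \<mu>)))"
      by (intro nn_integral_eq_integral) auto
    also have "expectation (\<lambda>\<omega>. (1 - exp (- (1 + \<mu>) * X h \<omega>)) / (1 + \<mu>)) = k"
      unfolding k_def using laplace[of h "1 + \<mu>"] h \<mu> prob_space by simp
    finally show ?thesis using h by (subst nn_integral_law) auto
  qed
  have cell: "(\<integral>\<^sup>+\<omega>. \<integral>\<^sup>+y. indicator {0<..} y * ennreal (exp (- y)) * kern \<mu> y (X (real n * h) \<omega>) (X (real n * h + h) \<omega>) \<partial>lborel \<partial>M)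
     = ennreal (exp (- h) ^ n * k)" for n
  proof -
    have "(\<integral>\<^sup>+\<omega>. \<integral>\<^sup>+y. indicator {0<..} y * ennreal (exp (- y)) * kern \<mu> y (X (real n * h) \<omega>) (X (real n * h + h) \<omega>) \<partial>lborel \<partial>M)
      = (\<integral>\<^sup>+\<omega>. ennreal (exp (- X (real n * h) \<omega>)) * ennreal ((1 - exp (- (1 + \<mu>) * (X (real n * h + h) \<omega> - X (real n * h) \<omega>))) / (1 + \<mu>)) \<partial>M)"
    proof (rule nn_integral_cong_AE)
      have "AE \<omega> in M. 0 \<le> X (real n * h) \<omega>" "AE \<omega> in M. X (real n * h) \<omega> \<le> X (real n * h + h) \<omega>"
        using h by (auto intro!: nonneg increment_nonneg)
      then show "AE \<omega> in M. (\<integral>\<^sup>+y. indicator {0<..} y * ennreal (exp (- y)) * kern \<mu> y (X (real n * h) \<omega>) (X (real n * h + h) \<omega>) \<partial>lborel)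
        = ennreal (exp (- X (real n * h) \<omega>)) * ennreal ((1 - exp (- (1 + \<mu>) * (X (real n * h + h) \<omega> - X (real n * h) \<omega>))) / (1 + \<mu>))"
        by eventually_elim (rule nn_integral_exp_kern[OF _ _ \<mu>])
    qed
    also have "\<dots> = (\<integral>\<^sup>+a. \<integral>\<^sup>+b. ennreal (exp (- a)) * ennreal ((1 - exp (- (1 + \<mu>) * (a + b - a))) / (1 + \<mu>)) \<partial>law h \<partial>law (real n * h))"
      using h by (intro nn_integral_two_times) auto
    also have "\<dots> = (\<integral>\<^sup>+a. ennreal (exp (- a)) * ennreal k \<partial>law (real n * h))"
      by (intro nn_integral_cong, subst nn_integral_cmult) (auto simp: jump[symmetric])
    also have "\<dots> = (\<integral>\<^sup>+\<omega>. ennreal (exp (- 1 * X (real n * h) \<omega>)) \<partial>M) * ennreal k"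
      using h by (subst nn_integral_multc) (auto simp: nn_integral_law)
    also have "\<dots> = ennreal (exp (- h) ^ n * k)"
      using h k nn_laplace[of "real n * h" 1] by (simp add: ennreal_mult exp_of_nat_mult[symmetric])
    finally show ?thesis .
  qed
  have "(\<integral>\<^sup>+y. indicator {0<..} y * ennreal (exp (- y)) * grid_mean h \<mu> y \<partial>lborel)
     = (\<integral>\<^sup>+y. \<integral>\<^sup>+\<omega>. (\<Sum>n. indicator {0<..} y * ennreal (exp (- y)) * kern \<mu> y (X (real n * h) \<omega>) (X (real n * h + h) \<omega>)) \<partial>M \<partial>lborel)"
    unfolding grid_mean_def by (subst nn_integral_cmult[symmetric]) auto
  also have "\<dots> = (\<integral>\<^sup>+\<omega>. \<integral>\<^sup>+y. (\<Sum>n. indicator {0<..} y * ennreal (exp (- y)) * kern \<mu> y (X (real n * h) \<omega>) (X (real n * h + h) \<omega>)) \<partial>lborel \<partial>M)"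
    by (intro L.Fubini'[symmetric]) (simp add: case_prod_beta)
  also have "\<dots> = (\<Sum>n. \<integral>\<^sup>+\<omega>. \<integral>\<^sup>+y. indicator {0<..} y * ennreal (exp (- y)) * kern \<mu> y (X (real n * h) \<omega>) (X (real n * h + h) \<omega>) \<partial>lborel \<partial>M)"
    by (simp add: nn_integral_suminf del: ennreal_suminf_cmult)
  also have "\<dots> = (\<Sum>n. ennreal (exp (- h) ^ n * k))" unfolding cell ..
  also have "\<dots> = ennreal (1 / (1 - exp (- h)) * k)"
    using h k by (intro suminf_ennreal_eq sums_mult2 geometric_sums) auto
  finally show ?thesis by (simp add: k_def mult.commute)
qed

section \<open>Averages over levels: the atom at 0 and the moment of order \<beta>\<close>

lemma measurable_undershoot_at [measurable]:
  "(\<lambda>\<omega>. undershoot (\<lambda>t. X t \<omega>) y) \<in> borel_measurable M"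
  using measurable_compose[OF measurable_Pair1' measurable_undershoot_process, of y] by simp

lemma measurable_undershoot_laplace [measurable (raw)]:
  assumes [measurable]: "f \<in> borel_measurable N" "g \<in> borel_measurable N"
  shows "(\<lambda>x. undershoot_laplace (f x) (g x)) \<in> borel_measurable N"
proof -
  have [measurable]: "(\<lambda>z. undershoot (\<lambda>t. X t (snd z)) (g (fst z))) \<in> borel_measurable (N \<Otimes>\<^sub>M M)"
    using measurable_compose[OF _ measurable_undershoot_process, of "\<lambda>z. (g (fst z), snd z)"] by simp
  show ?thesis unfolding undershoot_laplace_def
    by (intro borel_measurable_nn_integral) (simp add: case_prod_beta)
qed

lemma nn_integral_undershoot_laplace:
  assumes \<mu>: "0 \<le> \<mu>"
  shows "(\<integral>\<^sup>+y. indicator {0<..} y * ennreal (exp (- y)) * undershoot_laplace \<mu> y \<partial>lborel)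
    = ennreal ((1 + \<mu>) powr (\<beta> - 1))"
proof -
  define h where "h = (\<lambda>m. inverse (real (Suc m)))"
  have h: "\<And>m. 0 < h m" "h \<longlonglongrightarrow> 0" using LIMSEQ_inverse_real_of_nat by (auto simp: h_def)
  have [measurable]: "X (real n * h m) \<in> borel_measurable M" "X (real n * h m + h m) \<in> borel_measurable M" for n m
    using h(1)[of m] by auto
  have [measurable]: "grid_mean (h m) \<mu> \<in> borel_measurable borel" for m
    unfolding grid_mean_def[abs_def] by measurable
  have "(\<lambda>m. \<integral>\<^sup>+y. indicator {0<..} y * ennreal (exp (- y)) * grid_mean (h m) \<mu> y \<partial>lborel)
     \<longlonglongrightarrow> (\<integral>\<^sup>+y. indicator {0<..} y * ennreal (exp (- y)) * undershoot_laplace \<mu> y \<partial>lborel)"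
  proof (rule nn_integral_dominated_convergence[where w="\<lambda>y. indicator {0<..} y * ennreal (exp (- y))"])
    show "AE y in lborel. indicator {0<..} y * ennreal (exp (- y)) * grid_mean (h m) \<mu> y \<le> indicator {0<..} y * ennreal (exp (- y))" for m
      using mult_left_mono[OF grid_mean_le_1[OF h(1) _ \<mu>]] by (intro AE_I2) (auto simp: indicator_def)
    show "(\<integral>\<^sup>+y. indicator {0<..} y * ennreal (exp (- y)) \<partial>lborel) < \<infinity>"
      using nn_integral_exp_Ioi[of 1] by simp
    show "AE y in lborel. (\<lambda>m. indicator {0<..} y * ennreal (exp (- y)) * grid_mean (h m) \<mu> y)
       \<longlonglongrightarrow> indicator {0<..} y * ennreal (exp (- y)) * undershoot_laplace \<mu> y"
    proof (rule AE_I2)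
      fix y :: real
      show "(\<lambda>m. indicator {0<..} y * ennreal (exp (- y)) * grid_mean (h m) \<mu> y)
       \<longlonglongrightarrow> indicator {0<..} y * ennreal (exp (- y)) * undershoot_laplace \<mu> y"
      proof (cases "0 < y")
        case True
        then show ?thesis using grid_mean_tendsto[OF h True \<mu>]
          by (intro ennreal_tendsto_cmult) (auto simp: ennreal_mult_less_top)
      qed simp
    qed
  qed auto
  moreover have "(\<lambda>m. ennreal ((1 - exp (- h m * (1 + \<mu>) powr \<beta>)) / ((1 + \<mu>) * (1 - exp (- h m)))))
    \<longlonglongrightarrow> ennreal ((1 + \<mu>) powr (\<beta> - 1))"
  proof (rule tendsto_ennrealI)
    \<comment> \<open>Numerator and denominator are of order \<open>h * K\<close> and
      \<open>h\<close>, so their quotient tends to \<open>K\<close>; the factor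
      \<open>1 / (1 + \<mu>)\<close> lowers the exponent to \<beta> - 1.\<close>
    define K where "K = (1 + \<mu>) powr \<beta>"
    have K: "0 < K" using \<mu> by (simp add: K_def)
    have "(\<lambda>m. (1 - exp (- inverse (real (Suc m)) * K)) / (1 - exp (- inverse (real (Suc m))))) \<longlonglongrightarrow> K"
      using K by real_asymp
    then have "(\<lambda>m. (1 / (1 + \<mu>)) * ((1 - exp (- h m * K)) / (1 - exp (- h m)))) \<longlonglongrightarrow> (1 / (1 + \<mu>)) * K"
      unfolding h_def by (intro tendsto_mult tendsto_const)
    then show "(\<lambda>m. (1 - exp (- h m * (1 + \<mu>) powr \<beta>)) / ((1 + \<mu>) * (1 - exp (- h m)))) \<longlonglongrightarrow> (1 + \<mu>) powr (\<beta> - 1)"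
      using \<mu> by (simp add: K_def powr_diff)
  qed
  ultimately show ?thesis unfolding grid_mean_laplace[OF h(1) \<mu>] by (rule LIMSEQ_unique)
qed

text \<open>An atom at 0 bounds the Laplace transform from below for every parameter and, by
  scaling, at every level. The average over levels then bounds the atom by
  \<open>(1 + \<mu>) powr (\<beta> - 1)\<close>, which tends to 0 because \<beta> < 1.\<close>

lemma AE_undershoot_pos:
  assumes y: "0 < y"
  shows "AE \<omega> in M. 0 < undershoot (\<lambda>t. X t \<omega>) y"
proof -
  define a where "a = emeasure M {\<omega>\<in>space M. undershoot (\<lambda>t. X t \<omega>) y = 0}"
  have a: "a \<le> undershoot_laplace \<nu> y" for \<nu>
  proof -
    have "a = (\<integral>\<^sup>+\<omega>. indicator {\<omega>\<in>space M. undershoot (\<lambda>t. X t \<omega>) y = 0} \<omega> \<partial>M)" unfolding a_def by simp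
    also have "\<dots> \<le> undershoot_laplace \<nu> y"
      unfolding undershoot_laplace_def by (intro nn_integral_mono) (auto simp: indicator_def)
    finally show ?thesis .
  qed
  have le: "a \<le> ennreal ((1 + \<mu>) powr (\<beta> - 1))" if \<mu>: "0 \<le> \<mu>" for \<mu>
  proof -
    have "a = (\<integral>\<^sup>+z. indicator {0<..} z * ennreal (exp (- 1 * z)) * a \<partial>lborel)"
      using nn_integral_exp_Ioi[of 1] by (subst nn_integral_multc) auto
    also have "\<dots> \<le> (\<integral>\<^sup>+z. indicator {0<..} z * ennreal (exp (- z)) * undershoot_laplace \<mu> z \<partial>lborel)"
    proof (rule nn_integral_mono)
      fix z :: real
      \<comment> \<open>Level \<open>z\<close> is reached from \<open>y\<close> by the factor
        \<open>z / y\<close>, which changes the parameter to \<open>z / y * \<mu>\<close>; the atom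
        is a lower bound at that parameter too.\<close>
      have "a \<le> undershoot_laplace \<mu> z" if "0 < z"
        using a[of "z / y * \<mu>"] undershoot_laplace_scaling[of "z / y" y \<mu>] that y \<mu> by simp
      then show "indicator {0<..} z * ennreal (exp (- 1 * z)) * a \<le> indicator {0<..} z * ennreal (exp (- z)) * undershoot_laplace \<mu> z"
        by (auto simp: indicator_def intro!: mult_left_mono)
    qed
    also have "\<dots> = ennreal ((1 + \<mu>) powr (\<beta> - 1))" by (rule nn_integral_undershoot_laplace[OF \<mu>])
    finally show ?thesis .
  qed
  have "(\<lambda>n::nat. (1 + real n) powr (\<beta> - 1)) \<longlonglongrightarrow> 0" using \<beta> by real_asymp
  then have "(\<lambda>n::nat. ennreal ((1 + real n) powr (\<beta> - 1))) \<longlonglongrightarrow> ennreal 0" by (rule tendsto_ennrealI)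
  then have "a \<le> ennreal 0" using le by (intro LIMSEQ_le_const) auto
  then have "a = 0" by simp
  then have "AE \<omega> in M. undershoot (\<lambda>t. X t \<omega>) y \<noteq> 0"
    unfolding a_def by (subst AE_iff_measurable[OF _ refl]) auto
  then show ?thesis by eventually_elim (simp add: order_less_le undershoot_nonneg)
qed

text \<open>\<open>m powr (- \<beta> - 1)\<close> is not integrable at 0, so 1 and the Laplace
  transform cannot be integrated against it separately; their difference is handled as one
  nonnegative quantity.\<close>

definition undershoot_colaplace :: "real \<Rightarrow> real \<Rightarrow> ennreal" where
  "undershoot_colaplace \<mu> y = (\<integral>\<^sup>+\<omega>. ennreal (1 - exp (- \<mu> * undershoot (\<lambda>t. X t \<omega>) y)) \<partial>M)"

lemma undershoot_laplace_add:
  assumes "0 \<le> \<mu>"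
  shows "undershoot_colaplace \<mu> y + undershoot_laplace \<mu> y = 1"
proof -
  have "undershoot_colaplace \<mu> y + undershoot_laplace \<mu> y = (\<integral>\<^sup>+\<omega>. 1 \<partial>M)"
    unfolding undershoot_colaplace_def undershoot_laplace_def using assms
    by (subst nn_integral_add[symmetric])
       (auto intro!: nn_integral_cong simp: undershoot_nonneg ennreal_plus[symmetric] simp del: ennreal_plus)
  then show ?thesis by (simp add: emeasure_space_1)
qed

lemma undershoot_colaplace_eq:
  assumes "0 \<le> \<mu>"
  shows "undershoot_colaplace \<mu> y = 1 - undershoot_laplace \<mu> y"
proof -
  have "undershoot_laplace \<mu> y \<noteq> \<top>" using undershoot_laplace_add[OF assms, of y] by (auto simp: top_add)
  then show ?thesis using ennreal_add_diff_cancel_right[of "undershoot_laplace \<mu> y" "undershoot_colaplace \<mu> y"]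
    unfolding undershoot_laplace_add[OF assms] by simp
qed

lemma measurable_undershoot_colaplace [measurable (raw)]:
  assumes [measurable]: "f \<in> borel_measurable N" "g \<in> borel_measurable N"
  shows "(\<lambda>x. undershoot_colaplace (f x) (g x)) \<in> borel_measurable N"
proof -
  have [measurable]: "(\<lambda>z. undershoot (\<lambda>t. X t (snd z)) (g (fst z))) \<in> borel_measurable (N \<Otimes>\<^sub>M M)"
    using measurable_compose[OF _ measurable_undershoot_process, of "\<lambda>z. (g (fst z), snd z)"] by simp
  show ?thesis unfolding undershoot_colaplace_def
    by (intro borel_measurable_nn_integral) (simp add: case_prod_beta)
qed

lemma nn_integral_undershoot_colaplace:
  assumes \<mu>: "0 \<le> \<mu>"
  shows "(\<integral>\<^sup>+y. indicator {0<..} y * ennreal (exp (- y)) * undershoot_colaplace \<mu> y \<partial>lborel)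
    = ennreal (1 - (1 + \<mu>) powr (\<beta> - 1))"
proof -
  let ?c = "\<integral>\<^sup>+y. indicator {0<..} y * ennreal (exp (- y)) * undershoot_colaplace \<mu> y \<partial>lborel"
  have "?c + ennreal ((1 + \<mu>) powr (\<beta> - 1)) = (\<integral>\<^sup>+y. indicator {0<..} y * ennreal (exp (- 1 * y)) \<partial>lborel)"
    unfolding nn_integral_undershoot_laplace[OF \<mu>, symmetric]
    by (subst nn_integral_add[symmetric]) (auto simp: distrib_left[symmetric] undershoot_laplace_add[OF \<mu>])
  also have "\<dots> = 1" using nn_integral_exp_Ioi[of 1] by simp
  finally have "?c + ennreal ((1 + \<mu>) powr (\<beta> - 1)) = 1" .
  then have "?c = 1 - ennreal ((1 + \<mu>) powr (\<beta> - 1))"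
    using ennreal_add_diff_cancel_right[of "ennreal ((1 + \<mu>) powr (\<beta> - 1))" ?c] by simp
  then show ?thesis by (simp add: ennreal_minus flip: ennreal_1)
qed

text \<open>A double integral over the parameter \<open>m\<close> and the level \<open>z\<close> is
  evaluated in both orders. Integrating in \<open>m\<close> first gives a multiple of the moment at
  level \<open>z\<close>, proportional to \<open>z powr \<beta>\<close>, and then the factor Gamma(1
  + \<beta>); integrating in \<open>z\<close> first leaves an elementary integral equal to
  \<open>1 / \<beta>\<close>.\<close>

lemma nn_integral_undershoot_powr:
  assumes y: "0 < y"
  shows "(\<integral>\<^sup>+\<omega>. ennreal (undershoot (\<lambda>t. X t \<omega>) y powr \<beta>) \<partial>M) = ennreal (sin (\<beta> * pi) / (\<beta> * pi)) * ennreal (y powr \<beta>)"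
proof -
  interpret L: pair_sigma_finite lborel M ..
  define R where "R y = (\<integral>\<^sup>+m. indicator {0<..} m * ennreal (m powr (- \<beta> - 1)) * undershoot_colaplace m y \<partial>lborel)" for y
  have moment: "R z = ennreal (Gamma (1 - \<beta>) / \<beta>) * (\<integral>\<^sup>+\<omega>. ennreal (undershoot (\<lambda>t. X t \<omega>) z powr \<beta>) \<partial>M)" for z
  proof -
    have "R z = (\<integral>\<^sup>+m. \<integral>\<^sup>+\<omega>. indicator {0<..} m * ennreal ((1 - exp (- m * undershoot (\<lambda>t. X t \<omega>) z)) * m powr (- \<beta> - 1)) \<partial>M \<partial>lborel)"
      unfolding R_def undershoot_colaplace_def
      by (intro nn_integral_cong, subst nn_integral_cmult[symmetric])
         (auto intro!: nn_integral_cong simp: indicator_def ennreal_mult'' undershoot_nonneg mult.commute)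
    also have "\<dots> = (\<integral>\<^sup>+\<omega>. \<integral>\<^sup>+m. indicator {0<..} m * ennreal ((1 - exp (- m * undershoot (\<lambda>t. X t \<omega>) z)) * m powr (- \<beta> - 1)) \<partial>lborel \<partial>M)"
      by (intro L.Fubini'[symmetric]) (simp add: case_prod_beta)
    also have "\<dots> = (\<integral>\<^sup>+\<omega>. ennreal (Gamma (1 - \<beta>) / \<beta>) * ennreal (undershoot (\<lambda>t. X t \<omega>) z powr \<beta>) \<partial>M)"
      unfolding nn_integral_one_minus_exp_powr[OF \<beta> undershoot_nonneg]
      using \<beta> by (subst ennreal_mult') (auto intro!: divide_nonneg_pos less_imp_le Gamma_real_pos)
    finally show ?thesis by (simp add: nn_integral_cmult)
  qed
  \<comment> \<open>Substitute \<open>m / z\<close> for \<open>m\<close>: the Jacobian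
    \<open>1 / z\<close> and the factor \<open>z powr (\<beta> + 1)\<close> from the power combine
    to \<open>z powr \<beta>\<close>.\<close>
  have scale: "R z = ennreal (z powr \<beta>) * R 1" if z: "0 < z" for z
  proof -
    have "R z = ennreal (1 / z) * (\<integral>\<^sup>+m. indicator {0<..} (0 + 1 / z * m) * ennreal ((0 + 1 / z * m) powr (- \<beta> - 1)) * undershoot_colaplace (0 + 1 / z * m) z \<partial>lborel)"
      unfolding R_def using z by (subst nn_integral_real_affine[where c="1 / z" and t=0]) auto
    also have "(\<integral>\<^sup>+m. indicator {0<..} (0 + 1 / z * m) * ennreal ((0 + 1 / z * m) powr (- \<beta> - 1)) * undershoot_colaplace (0 + 1 / z * m) z \<partial>lborel)
       = (\<integral>\<^sup>+m. ennreal (z powr (\<beta> + 1)) * (indicator {0<..} m * ennreal (m powr (- \<beta> - 1)) * undershoot_colaplace m 1) \<partial>lborel)"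
    proof (rule nn_integral_cong)
      fix m :: real
      show "indicator {0<..} (0 + 1 / z * m) * ennreal ((0 + 1 / z * m) powr (- \<beta> - 1)) * undershoot_colaplace (0 + 1 / z * m) z
        = ennreal (z powr (\<beta> + 1)) * (indicator {0<..} m * ennreal (m powr (- \<beta> - 1)) * undershoot_colaplace m 1)"
      proof (cases "0 < m")
        case True
        have "undershoot_colaplace (m / z) z = undershoot_colaplace m 1"
          using undershoot_laplace_scaling[of z 1 "m / z"] z True by (simp add: undershoot_colaplace_eq)
        moreover have "(m / z) powr (- \<beta> - 1) = z powr (\<beta> + 1) * m powr (- \<beta> - 1)"
        proof -
          have "(m / z) powr (- \<beta> - 1) = m powr (- \<beta> - 1) / z powr (- \<beta> - 1)"
            using z True by (intro powr_divide)
          also have "z powr (- \<beta> - 1) = inverse (z powr (\<beta> + 1))"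
            using powr_minus[of z "\<beta> + 1"] by simp
          finally show ?thesis by (simp add: divide_inverse_commute)
        qed
        ultimately show ?thesis using True z by (simp add: ennreal_mult' mult.assoc)
      next
        case False
        then have "\<not> 0 < m / z" using z by (simp add: zero_less_divide_iff)
        then show ?thesis using False by simp
      qed
    qed
    also have "\<dots> = ennreal (z powr (\<beta> + 1)) * R 1" unfolding R_def by (subst nn_integral_cmult) auto
    also have "ennreal (1 / z) * \<dots> = ennreal (z powr \<beta>) * R 1"
      using z by (simp add: mult.assoc[symmetric] ennreal_mult[symmetric] powr_add)
    finally show ?thesis .
  qed
  have "ennreal (Gamma (1 + \<beta>)) * R 1 = (\<integral>\<^sup>+z. indicator {0<..} z * ennreal (z powr (1 + \<beta> - 1) * exp (- 1 * z)) * R 1 \<partial>lborel)"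
    using nn_integral_Gamma_Ioi[of "1 + \<beta>" 1] \<beta> by (subst nn_integral_multc) auto
  also have "\<dots> = (\<integral>\<^sup>+z. indicator {0<..} z * ennreal (exp (- z)) * R z \<partial>lborel)"
  proof (rule nn_integral_cong)
    fix z :: real
    show "indicator {0<..} z * ennreal (z powr (1 + \<beta> - 1) * exp (- 1 * z)) * R 1 = indicator {0<..} z * ennreal (exp (- z)) * R z"
    proof (cases "0 < z")
      case True
      show ?thesis unfolding scale[OF True] using True by (simp add: ennreal_mult' mult_ac)
    qed simp
  qed
  also have "\<dots> = (\<integral>\<^sup>+z. \<integral>\<^sup>+m. (indicator {0<..} m * ennreal (m powr (- \<beta> - 1))) * (indicator {0<..} z * ennreal (exp (- z)) * undershoot_colaplace m z) \<partial>lborel \<partial>lborel)"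
    unfolding R_def by (subst nn_integral_cmult[symmetric]) (auto intro!: nn_integral_cong simp: mult_ac)
  also have "\<dots> = (\<integral>\<^sup>+m. \<integral>\<^sup>+z. (indicator {0<..} m * ennreal (m powr (- \<beta> - 1))) * (indicator {0<..} z * ennreal (exp (- z)) * undershoot_colaplace m z) \<partial>lborel \<partial>lborel)"
    by (intro lborel_pair.Fubini') (simp add: case_prod_beta)
  also have "\<dots> = (\<integral>\<^sup>+m. indicator {0<..} m * ennreal ((1 - (1 + m) powr (\<beta> - 1)) * m powr (- \<beta> - 1)) \<partial>lborel)"
  proof (rule nn_integral_cong)
    fix m :: real
    have "(\<integral>\<^sup>+z. (indicator {0<..} m * ennreal (m powr (- \<beta> - 1))) * (indicator {0<..} z * ennreal (exp (- z)) * undershoot_colaplace m z) \<partial>lborel)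
      = indicator {0<..} m * ennreal (m powr (- \<beta> - 1)) * (\<integral>\<^sup>+z. indicator {0<..} z * ennreal (exp (- z)) * undershoot_colaplace m z \<partial>lborel)"
      by (rule nn_integral_cmult) measurable
    also have "\<dots> = indicator {0<..} m * ennreal ((1 - (1 + m) powr (\<beta> - 1)) * m powr (- \<beta> - 1))"
    proof (cases "0 < m")
      case True
      then show ?thesis by (subst nn_integral_undershoot_colaplace) (auto simp: ennreal_mult' mult.commute)
    qed simp
    finally show "(\<integral>\<^sup>+z. (indicator {0<..} m * ennreal (m powr (- \<beta> - 1))) * (indicator {0<..} z * ennreal (exp (- z)) * undershoot_colaplace m z) \<partial>lborel)
      = indicator {0<..} m * ennreal ((1 - (1 + m) powr (\<beta> - 1)) * m powr (- \<beta> - 1))" .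
  qed
  also have "\<dots> = ennreal (1 / \<beta>)" using \<beta> by (rule nn_integral_one_minus_powr_powr)
  finally have R1: "ennreal (Gamma (1 + \<beta>)) * R 1 = ennreal (1 / \<beta>)" .
  let ?m = "\<integral>\<^sup>+\<omega>. ennreal (undershoot (\<lambda>t. X t \<omega>) y powr \<beta>) \<partial>M"
  define s where "s = sin (\<beta> * pi) / (\<beta> * pi)"
  have sin: "0 < sin (\<beta> * pi)" using \<beta> by (intro sin_gt_zero) auto
  then have s: "0 < s" using \<beta> by (simp add: s_def)
  \<comment> \<open>By reflection the Gamma factors give pi / sin(\<beta> pi) = 1 / (s \<beta>); the
    \<open>1 / \<beta>\<close> from the other order of integration then leaves exactly
    \<open>s\<close>.\<close>
  have G: "Gamma (1 + \<beta>) * (Gamma (1 - \<beta>) / \<beta>) = 1 / (s * \<beta>)"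
    using Gamma_reflection_real[OF \<beta>] sin \<beta> by (simp add: s_def)
  have Gp: "0 \<le> Gamma (1 + \<beta>)" "0 \<le> Gamma (1 - \<beta>)" using \<beta> by (auto intro!: less_imp_le Gamma_real_pos)
  have "ennreal (1 / (s * \<beta>)) * ?m = ennreal (Gamma (1 + \<beta>)) * R y"
    unfolding moment G[symmetric] using Gp \<beta> by (subst ennreal_mult) (auto simp: mult.assoc)
  also have "\<dots> = ennreal (y powr \<beta>) * ennreal (1 / \<beta>)"
    unfolding scale[OF y] R1[symmetric] by (simp add: mult_ac)
  finally have "ennreal (s * \<beta>) * (ennreal (1 / (s * \<beta>)) * ?m) = ennreal (s * \<beta>) * (ennreal (y powr \<beta>) * ennreal (1 / \<beta>))"
    by simp
  moreover have "ennreal (s * \<beta>) * (ennreal (1 / (s * \<beta>)) * ?m) = ?m"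
    using s \<beta> by (simp add: mult.assoc[symmetric] ennreal_mult[symmetric])
  moreover have "ennreal (s * \<beta>) * (ennreal (y powr \<beta>) * ennreal (1 / \<beta>)) = ennreal s * ennreal (y powr \<beta>)"
    using s \<beta> by (simp add: ennreal_mult[symmetric])
  ultimately show ?thesis unfolding s_def by simp
qed

end

section \<open>The censored process\<close>

text \<open>The exceptional set lies in a null set, all of whose subsets are measurable in the
  completion. This serves the constructed times, which equal measurable sums only almost
  surely.\<close>

lemma borel_measurable_completion_AE_cong:
  assumes "g \<in> borel_measurable M" "AE x in M. f x = g x"
  shows "f \<in> borel_measurable (completion M)"
proof (rule measurableI)
  obtain N where N: "{x\<in>space M. f x \<noteq> g x} \<subseteq> N" "N \<in> null_sets M"
    using assms(2) by (auto elim!: AE_E simp: null_sets_def)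
  fix A :: "'b set" assume A: "A \<in> sets borel"
  have "f -` A \<inter> space (completion M) = (g -` A \<inter> space M - N) \<union> (f -` A \<inter> space M \<inter> N)"
    using N(1) by auto
  also have "\<dots> \<in> sets (completion M)"
  proof (rule sets.Un)
    show "g -` A \<inter> space M - N \<in> sets (completion M)"
      using assms(1) A N(2) by (intro sets_completionI_sets sets.Diff measurable_sets) auto
    show "f -` A \<inter> space M \<inter> N \<in> sets (completion M)"
      using N(2) by (rule null_sets_completion) auto
  qed
  finally show "f -` A \<inter> space (completion M) \<in> sets (completion M)" .
qed auto

text \<open>Under the product law the second argument may be evaluated at an independent sample
  point. The inner integral then has a frozen first argument, so results for fixed levels
  apply.\<close>

lemma (in prob_space) nn_integral_indep_var:
  assumes "indep_var N1 A N2 B" and [measurable]: "(\<lambda>(a, b). F a b) \<in> borel_measurable (N1 \<Otimes>\<^sub>M N2)"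
  shows "(\<integral>\<^sup>+\<omega>. F (A \<omega>) (B \<omega>) \<partial>M) = (\<integral>\<^sup>+\<omega>. \<integral>\<^sup>+\<omega>'. F (A \<omega>) (B \<omega>') \<partial>M \<partial>M)"
proof -
  have [measurable]: "A \<in> measurable M N1" "B \<in> measurable M N2"
    using assms(1) by (auto dest: indep_var_rv1 indep_var_rv2)
  interpret B: prob_space "distr M N2 B" by (rule prob_space_distr) simp
  have [measurable]: "(\<lambda>z. F (fst z) (snd z)) \<in> borel_measurable (N1 \<Otimes>\<^sub>M N2)"
    using assms(2) by (simp add: case_prod_beta)
  have "(\<integral>\<^sup>+\<omega>. F (A \<omega>) (B \<omega>) \<partial>M) = (\<integral>\<^sup>+z. F (fst z) (snd z) \<partial>distr M (N1 \<Otimes>\<^sub>M N2) (\<lambda>\<omega>. (A \<omega>, B \<omega>)))"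
    by (subst nn_integral_distr) auto
  also have "\<dots> = (\<integral>\<^sup>+z. F (fst z) (snd z) \<partial>(distr M N1 A \<Otimes>\<^sub>M distr M N2 B))"
    using assms(1) by (simp add: indep_var_distribution_eq)
  also have "\<dots> = (\<integral>\<^sup>+a. \<integral>\<^sup>+b. F a b \<partial>distr M N2 B \<partial>distr M N1 A)"
    by (subst B.nn_integral_fst[symmetric]) auto
  also have "\<dots> = (\<integral>\<^sup>+\<omega>. \<integral>\<^sup>+b. F (A \<omega>) b \<partial>distr M N2 B \<partial>M)"
    by (subst nn_integral_distr) (auto intro!: B.borel_measurable_nn_integral)
  also have "\<dots> = (\<integral>\<^sup>+\<omega>. \<integral>\<^sup>+\<omega>'. F (A \<omega>) (B \<omega>') \<partial>M \<partial>M)"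
  proof (intro nn_integral_cong nn_integral_distr)
    fix \<omega> assume "\<omega> \<in> space M"
    then have "A \<omega> \<in> space N1" by (rule measurable_space[rotated]) simp
    from measurable_compose[OF measurable_Pair1'[OF this] assms(2)]
    show "F (A \<omega>) \<in> borel_measurable (distr M N2 B)" by simp
  qed simp
  finally show ?thesis .
qed

section \<open>Restart levels as functions of the driving paths\<close>

lemma restart_cong: "(\<And>i. 1 \<le> i \<Longrightarrow> i \<le> j \<Longrightarrow> f i = g i) \<Longrightarrow> restart x f j = restart x g j"
  by (induction j) auto

lemma restart_trajectory:
  "restart x (\<lambda>j. trajectory (X j) \<omega>) j = restart x (\<lambda>j t. X j t \<omega>) j"
  by (induction j) (auto simp: undershoot_trajectory)

lemma measurable_restart:
  "{1..j} \<subseteq> I \<Longrightarrow> (\<lambda>f. restart x f j) \<in> borel_measurable (PiM I (\<lambda>_. path_space))"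
proof (induction j)
  case (Suc j)
  have [measurable]: "(\<lambda>f. restart x f j) \<in> borel_measurable (PiM I (\<lambda>_. path_space))"
    using Suc.prems by (intro Suc.IH) auto
  have [measurable]: "(\<lambda>f. f (Suc j)) \<in> measurable (PiM I (\<lambda>_. path_space)) path_space"
    using Suc.prems by (intro measurable_component_singleton) auto
  have "(\<lambda>f. undershoot (f (Suc j)) (restart x f j)) \<in> borel_measurable (PiM I (\<lambda>_. path_space))"
    using measurable_compose[OF _ measurable_undershoot, of "\<lambda>f. (restart x f j, f (Suc j))"] by simp
  then show ?case by simp
qed simp

lemma restart_restrict: "restart x (restrict f {1..j}) j = restart x f j"
  by (rule restart_cong) auto

lemma measurable_restart_process:
  assumes "\<And>i. 1 \<le> i \<Longrightarrow> Z i \<in> measurable M path_space"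
  shows "(\<lambda>\<omega>. restart x (\<lambda>i. Z i \<omega>) j) \<in> borel_measurable M"
proof -
  have "(\<lambda>\<omega>. restrict (\<lambda>i. Z i \<omega>) {1..j}) \<in> measurable M (PiM {1..j} (\<lambda>_. path_space))"
    using assms by (intro measurable_restrict) auto
  from measurable_compose[OF this measurable_restart[OF order_refl, of x]] show ?thesis
    unfolding restart_restrict .
qed

text \<open>The level after \<open>j\<close> rounds reads only paths 1 to \<open>j\<close>, hence is
  independent of path \<open>j + 1\<close>. Freezing it plays the role of a Markov property at the
  restart times.\<close>

lemma (in prob_space) nn_integral_restart:
  assumes ind: "indep_vars (\<lambda>_. path_space) Z {1..}"
    and F: "(\<lambda>(y, p). F y p) \<in> borel_measurable (borel \<Otimes>\<^sub>M path_space)"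
  shows "(\<integral>\<^sup>+\<omega>. F (restart x (\<lambda>i. Z i \<omega>) j) (Z (Suc j) \<omega>) \<partial>M)
    = (\<integral>\<^sup>+\<omega>. \<integral>\<^sup>+\<omega>'. F (restart x (\<lambda>i. Z i \<omega>) j) (Z (Suc j) \<omega>') \<partial>M \<partial>M)"
proof -
  have "indep_var (PiM {1..j} (\<lambda>_. path_space)) (\<lambda>\<omega>. restrict (\<lambda>i. Z i \<omega>) {1..j})
     (PiM {Suc j} (\<lambda>_. path_space)) (\<lambda>\<omega>. restrict (\<lambda>i. Z i \<omega>) {Suc j})"
    using ind by (rule indep_var_restrict) auto
  moreover have "(\<lambda>(f, g). F (restart x f j) (g (Suc j)))
     \<in> borel_measurable (PiM {1..j} (\<lambda>_. path_space) \<Otimes>\<^sub>M PiM {Suc j} (\<lambda>_. path_space))"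
  proof -
    have [measurable]: "(\<lambda>f. restart x f j) \<in> borel_measurable (PiM {1..j} (\<lambda>_. path_space))"
      by (rule measurable_restart) simp
    have [measurable]: "(\<lambda>g. g (Suc j)) \<in> measurable (PiM {Suc j} (\<lambda>_. path_space)) path_space"
      by (rule measurable_component_singleton) simp
    have "(\<lambda>z. (restart x (fst z) j, snd z (Suc j)))
      \<in> measurable (PiM {1..j} (\<lambda>_. path_space) \<Otimes>\<^sub>M PiM {Suc j} (\<lambda>_. path_space)) (borel \<Otimes>\<^sub>M path_space)"
      by measurable
    from measurable_compose[OF this F] show ?thesis by (simp add: case_prod_beta)
  qed
  ultimately have "(\<integral>\<^sup>+\<omega>. F (restart x (restrict (\<lambda>i. Z i \<omega>) {1..j}) j) (restrict (\<lambda>i. Z i \<omega>) {Suc j} (Suc j)) \<partial>M)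
    = (\<integral>\<^sup>+\<omega>. \<integral>\<^sup>+\<omega>'. F (restart x (restrict (\<lambda>i. Z i \<omega>) {1..j}) j) (restrict (\<lambda>i. Z i \<omega>') {Suc j} (Suc j)) \<partial>M \<partial>M)"
    by (rule nn_integral_indep_var)
  then show ?thesis by (simp add: restart_restrict del: One_nat_def)
qed

text \<open>Applied at \<open>\<beta> * pi\<close>, this makes the ratio of the geometric series
  less than 1.\<close>

lemma sin_less_self:
  fixes t :: real
  assumes "0 < t" "t \<le> pi"
  shows "sin t < t"
proof -
  obtain z where z: "0 < z" "z < t" "sin t - sin 0 = (t - 0) * cos z"
    using MVT2[OF assms(1), of sin cos] by (metis DERIV_sin)
  have "cos z < 1" using cos_monotone_0_pi[of 0 z] z assms by simp
  then show ?thesis using z assms mult_strict_left_mono[of "cos z" 1 t] by simp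
qed

theorem theorem4p2:
  fixes M :: "'a measure" and S :: "nat \<Rightarrow> real \<Rightarrow> 'a \<Rightarrow> real" and \<beta> x :: real
  assumes "0 < \<beta>" and "\<beta> < 1"
    and "prob_space M"
    and "\<And>j. 1 \<le> j \<Longrightarrow> stable_subordinator M \<beta> (\<lambda>s \<omega>. - S j s \<omega>)"
    and "iid_processes M {1..} (\<lambda>j s \<omega>. - S j s \<omega>)"
    and "0 < x"
  shows "(\<lambda>\<omega>. cens_time (\<lambda>j t. S j t \<omega>) x 1) \<in> borel_measurable (completion M) \<and>
         (\<lambda>\<omega>. cens_lifetime (\<lambda>j t. S j t \<omega>) x) \<in> borel_measurable (completion M) \<and>
         (\<integral>\<^sup>+\<omega>. cens_lifetime (\<lambda>j t. S j t \<omega>) x \<partial>M) < \<infinity> \<and>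
         (\<integral>\<^sup>+\<omega>. cens_lifetime (\<lambda>j t. S j t \<omega>) x \<partial>M) =
           (\<integral>\<^sup>+\<omega>. cens_time (\<lambda>j t. S j t \<omega>) x 1 \<partial>M) *
             ennreal (inverse (1 - sin (\<beta> * pi) / (\<beta> * pi)))"
proof -
  interpret prob_space M by fact
  define Z where "Z = (\<lambda>j. trajectory (\<lambda>s \<omega>. - S j s \<omega>))"
  \<comment> \<open>\<open>Y j\<close> is the starting level of piece \<open>j + 1\<close> and
    \<open>\<sigma> j\<close> its candidate duration; both are measurable on \<open>M\<close>
    itself, while the constructed times are treated on its completion.\<close>
  define Y where "Y = (\<lambda>j \<omega>. restart x (\<lambda>i. Z i \<omega>) j)"
  define \<sigma> where "\<sigma> = (\<lambda>j \<omega>. passage (Z (Suc j) \<omega>) (Y j \<omega>))"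
  define q where "q = sin (\<beta> * pi) / (\<beta> * pi)"
  define C where "C = (\<integral>\<^sup>+\<omega>. passage (Z 1 \<omega>) 1 \<partial>M)"
  have X: "stable_subordinator_process M (\<lambda>s \<omega>. - S (Suc j) s \<omega>) \<beta>" for j
    by (intro stable_subordinator_process.intro stable_subordinator_process_axioms.intro assms) simp
  have ind: "indep_vars (\<lambda>_. path_space) Z {1..}"
    and id: "\<forall>i\<in>{1..}. \<forall>j\<in>{1..}. distr M path_space (Z i) = distr M path_space (Z j)"
    using assms(5) unfolding iid_processes_def Z_def by (rule conjunct1, rule conjunct2)
  have Z [measurable]: "Z (Suc j) \<in> measurable M path_space" for j
    using ind by (auto simp: indep_vars_def)
  have Y [measurable]: "Y j \<in> borel_measurable M" for j
    unfolding Y_def using ind by (intro measurable_restart_process) (auto simp: indep_vars_def)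
  have Y_Suc: "Y (Suc j) \<omega> = undershoot (Z (Suc j) \<omega>) (Y j \<omega>)" for j \<omega> by (simp add: Y_def)
  have \<sigma> [measurable]: "\<sigma> j \<in> borel_measurable M" for j
    using measurable_compose[OF _ measurable_passage, of "\<lambda>\<omega>. (Y j \<omega>, Z (Suc j) \<omega>)" M] by (simp add: \<sigma>_def)

  have mean: "(\<integral>\<^sup>+\<omega>. passage (Z (Suc j) \<omega>) y \<partial>M) = ennreal (y powr \<beta>) * C" if "0 < y" for j y
  proof -
    have [measurable]: "(\<lambda>p. passage p 1) \<in> borel_measurable path_space"
      using measurable_compose[OF measurable_Pair1' measurable_passage, of 1] by simp
    have "(\<integral>\<^sup>+\<omega>. passage (Z (Suc j) \<omega>) 1 \<partial>M) = (\<integral>\<^sup>+p. passage p 1 \<partial>distr M path_space (Z (Suc j)))"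
      by (subst nn_integral_distr) auto
    \<comment> \<open>The mean passage at level 1 is a functional of the law on
      \<open>path_space\<close>, so identical distribution gives every piece the same constant
      \<open>C\<close>.\<close>
    also have "distr M path_space (Z (Suc j)) = distr M path_space (Z (Suc 0))" by (rule id[rule_format]) auto
    also have "(\<integral>\<^sup>+p. passage p 1 \<partial>distr M path_space (Z (Suc 0))) = C"
      unfolding C_def by (subst nn_integral_distr) auto
    finally have "(\<integral>\<^sup>+\<omega>. passage (\<lambda>s. - S (Suc j) s \<omega>) 1 \<partial>M) = C" by (simp add: Z_def passage_trajectory)
    then show ?thesis
      using stable_subordinator_process.nn_integral_passage[OF X that]
      unfolding stable_subordinator_process.mean_passage_def[OF X] by (simp add: Z_def passage_trajectory)
  qed
  have C: "C < \<infinity>"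
    using stable_subordinator_process.mean_passage_finite[OF X, of 0]
    unfolding stable_subordinator_process.mean_passage_def[OF X] by (simp add: C_def Z_def passage_trajectory)
  have moment: "(\<integral>\<^sup>+\<omega>. ennreal (undershoot (Z (Suc j) \<omega>) y powr \<beta>) \<partial>M) = ennreal q * ennreal (y powr \<beta>)" if "0 < y" for j y
    using stable_subordinator_process.nn_integral_undershoot_powr[OF X that]
    by (simp add: Z_def undershoot_trajectory q_def)

  have Y_pos: "AE \<omega> in M. 0 < Y j \<omega>" for j
  proof (induction j)
    case 0
    then show ?case using assms by (simp add: Y_def)
  next
    case (Suc j)
    \<comment> \<open>The event of a nonpositive restart level is encoded as an
      \<open>ennreal\<close> indicator so that the previous level can be frozen; a zero integral
      then returns the almost sure statement.\<close>
    define F :: "real \<Rightarrow> (real \<Rightarrow> real) \<Rightarrow> ennreal" where "F y p = (if undershoot p y \<le> 0 then 1 else 0)" for y p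
    have F [measurable]: "(\<lambda>(y, p). F y p) \<in> borel_measurable (borel \<Otimes>\<^sub>M path_space)"
      unfolding F_def case_prod_beta using measurable_undershoot by (simp add: case_prod_beta)
    have [measurable]: "(\<lambda>\<omega>. F (Y j \<omega>) (Z (Suc j) \<omega>)) \<in> borel_measurable M"
      using measurable_compose[OF _ F, of "\<lambda>\<omega>. (Y j \<omega>, Z (Suc j) \<omega>)" M] by simp
    have "(\<integral>\<^sup>+\<omega>. F (Y j \<omega>) (Z (Suc j) \<omega>) \<partial>M) = (\<integral>\<^sup>+\<omega>. \<integral>\<^sup>+\<omega>'. F (Y j \<omega>) (Z (Suc j) \<omega>') \<partial>M \<partial>M)"
      unfolding Y_def by (rule nn_integral_restart[OF ind F])
    also have "\<dots> = (\<integral>\<^sup>+\<omega>. 0 \<partial>M)"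
    proof (rule nn_integral_cong_AE)
      show "AE \<omega> in M. (\<integral>\<^sup>+\<omega>'. F (Y j \<omega>) (Z (Suc j) \<omega>') \<partial>M) = 0" using Suc
      proof eventually_elim
        case (elim \<omega>)
        have "AE \<omega>' in M. F (Y j \<omega>) (Z (Suc j) \<omega>') = 0"
          using stable_subordinator_process.AE_undershoot_pos[OF X[of j] elim]
          by eventually_elim (simp add: F_def Z_def undershoot_trajectory)
        then have "(\<integral>\<^sup>+\<omega>'. F (Y j \<omega>) (Z (Suc j) \<omega>') \<partial>M) = (\<integral>\<^sup>+\<omega>'. 0 \<partial>M)" by (rule nn_integral_cong_AE)
        then show ?case by simp
      qed
    qed
    finally have "AE \<omega> in M. F (Y j \<omega>) (Z (Suc j) \<omega>) = 0" by (simp add: nn_integral_0_iff_AE)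
    then show ?case unfolding Y_Suc by eventually_elim (auto simp: F_def split: if_splits)
  qed

  have q0: "0 < q" using assms by (auto simp: q_def intro!: divide_pos_pos sin_gt_zero)
  have q1: "q < 1"
  proof -
    have "sin (\<beta> * pi) < \<beta> * pi" using assms by (intro sin_less_self) auto
    then show ?thesis using assms by (simp add: q_def)
  qed

  \<comment> \<open>With the level frozen at a positive value, each restart multiplies the moment of
    order \<beta> by \<open>q\<close>.\<close>
  have EY: "(\<integral>\<^sup>+\<omega>. ennreal (Y j \<omega> powr \<beta>) \<partial>M) = ennreal (q ^ j * x powr \<beta>)" for j
  proof (induction j)
    case 0
    then show ?case by (simp add: Y_def emeasure_space_1)
  next
    case (Suc j)
    have F: "(\<lambda>(y, p). ennreal (undershoot p y powr \<beta>)) \<in> borel_measurable (borel \<Otimes>\<^sub>M path_space)"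
      using measurable_undershoot by (simp add: case_prod_beta)
    have "(\<integral>\<^sup>+\<omega>. ennreal (Y (Suc j) \<omega> powr \<beta>) \<partial>M)
        = (\<integral>\<^sup>+\<omega>. \<integral>\<^sup>+\<omega>'. ennreal (undershoot (Z (Suc j) \<omega>') (Y j \<omega>) powr \<beta>) \<partial>M \<partial>M)"
      unfolding Y_Suc unfolding Y_def by (rule nn_integral_restart[OF ind F])
    also have "\<dots> = (\<integral>\<^sup>+\<omega>. ennreal q * ennreal (Y j \<omega> powr \<beta>) \<partial>M)"
      using Y_pos[of j] by (intro nn_integral_cong_AE) (auto elim!: eventually_mono simp: moment)
    also have "\<dots> = ennreal q * ennreal (q ^ j * x powr \<beta>)"
      by (subst nn_integral_cmult) (auto simp: Suc)
    finally show ?case using q0 by (simp add: ennreal_mult[symmetric] mult.assoc)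
  qed
  have E\<sigma>: "(\<integral>\<^sup>+\<omega>. \<sigma> j \<omega> \<partial>M) = ennreal (q ^ j * x powr \<beta>) * C" for j
  proof -
    have "(\<integral>\<^sup>+\<omega>. \<sigma> j \<omega> \<partial>M) = (\<integral>\<^sup>+\<omega>. \<integral>\<^sup>+\<omega>'. passage (Z (Suc j) \<omega>') (Y j \<omega>) \<partial>M \<partial>M)"
      unfolding \<sigma>_def Y_def by (rule nn_integral_restart[OF ind measurable_passage])
    also have "\<dots> = (\<integral>\<^sup>+\<omega>. ennreal (Y j \<omega> powr \<beta>) * C \<partial>M)"
      using Y_pos[of j] by (intro nn_integral_cong_AE) (auto elim!: eventually_mono simp: mean)
    also have "\<dots> = ennreal (q ^ j * x powr \<beta>) * C" by (subst nn_integral_multc) (auto simp: EY)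
    finally show ?thesis .
  qed

  \<comment> \<open>There are countably many pieces, so outside a single null set all paths are
    regular and all restart levels positive, and the pathwise identification holds for every
    \<open>j\<close> at once.\<close>
  have "AE \<omega> in M. \<forall>j. subordinator_path (\<lambda>t. - S (Suc j) t \<omega>)"
    unfolding AE_all_countable using stable_subordinator_process.AE_subordinator_path[OF X] by simp
  moreover have "AE \<omega> in M. \<forall>j. 0 < Y j \<omega>" using Y_pos by (simp add: AE_all_countable)
  ultimately have times: "AE \<omega> in M. \<forall>j. cens_time (\<lambda>j t. S j t \<omega>) x j = (\<Sum>i<j. \<sigma> i \<omega>)"
  proof eventually_elim
    case (elim \<omega>)
    have "subordinator_path (\<lambda>t. - S j t \<omega>)" if "1 \<le> j" for j
      using elim(1)[rule_format, of "j - 1"] that by simp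
    moreover have "0 < restart x (\<lambda>j t. - S j t \<omega>) j" for j
      using elim(2) by (simp add: Y_def Z_def restart_trajectory)
    ultimately show ?case
      using cens_piece_and_time_eq[of "\<lambda>j t. S j t \<omega>" x]
      by (simp add: \<sigma>_def Y_def Z_def restart_trajectory passage_trajectory)
  qed
  then have time1: "AE \<omega> in M. cens_time (\<lambda>j t. S j t \<omega>) x 1 = \<sigma> 0 \<omega>"
  proof eventually_elim
    case (elim \<omega>)
    show ?case using elim[rule_format, of 1] by simp
  qed
  \<comment> \<open>Every series converges in \<open>ennreal\<close>, so the lifetime is identified
    with the sum of durations before it is known to be finite.\<close>
  have life: "AE \<omega> in M. cens_lifetime (\<lambda>j t. S j t \<omega>) x = (\<Sum>i. \<sigma> i \<omega>)"
    using times
  proof eventually_elim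
    case (elim \<omega>)
    have "(\<lambda>j. \<Sum>i<j. \<sigma> i \<omega>) \<longlonglongrightarrow> cens_lifetime (\<lambda>j t. S j t \<omega>) x"
      using cens_time_tendsto_lifetime[of "\<lambda>j t. S j t \<omega>" x] unfolding elim[rule_format] .
    moreover have "(\<lambda>j. \<Sum>i<j. \<sigma> i \<omega>) \<longlonglongrightarrow> (\<Sum>i. \<sigma> i \<omega>)" by (rule summable_LIMSEQ) simp
    ultimately show ?case by (rule LIMSEQ_unique)
  qed
  have E1: "(\<integral>\<^sup>+\<omega>. cens_time (\<lambda>j t. S j t \<omega>) x 1 \<partial>M) = ennreal (x powr \<beta>) * C"
    using nn_integral_cong_AE[OF time1] E\<sigma>[of 0] by simp
  have "(\<integral>\<^sup>+\<omega>. cens_lifetime (\<lambda>j t. S j t \<omega>) x \<partial>M) = (\<Sum>j. ennreal (q ^ j * x powr \<beta>) * C)"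
    unfolding nn_integral_cong_AE[OF life] by (simp add: nn_integral_suminf E\<sigma>)
  also have "\<dots> = (\<Sum>j. ennreal (q ^ j * x powr \<beta>)) * C" by (rule ennreal_suminf_multc)
  also have "(\<Sum>j. ennreal (q ^ j * x powr \<beta>)) = ennreal (1 / (1 - q) * x powr \<beta>)"
    using q0 q1 by (intro suminf_ennreal_eq sums_mult2 geometric_sums) auto
  also have "\<dots> = ennreal (inverse (1 - q)) * ennreal (x powr \<beta>)"
    using q1 by (subst ennreal_mult[symmetric]) (auto simp: inverse_eq_divide)
  finally have E: "(\<integral>\<^sup>+\<omega>. cens_lifetime (\<lambda>j t. S j t \<omega>) x \<partial>M) = ennreal (inverse (1 - q)) * ennreal (x powr \<beta>) * C" .
  show ?thesis
  proof (intro conjI)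
    show "(\<lambda>\<omega>. cens_time (\<lambda>j t. S j t \<omega>) x 1) \<in> borel_measurable (completion M)"
      by (rule borel_measurable_completion_AE_cong[OF \<sigma>[of 0] time1])
    show "(\<lambda>\<omega>. cens_lifetime (\<lambda>j t. S j t \<omega>) x) \<in> borel_measurable (completion M)"
      by (rule borel_measurable_completion_AE_cong[OF _ life]) measurable
    show "(\<integral>\<^sup>+\<omega>. cens_lifetime (\<lambda>j t. S j t \<omega>) x \<partial>M) < \<infinity>"
      unfolding E using C by (simp add: ennreal_mult_less_top)
    show "(\<integral>\<^sup>+\<omega>. cens_lifetime (\<lambda>j t. S j t \<omega>) x \<partial>M) =
           (\<integral>\<^sup>+\<omega>. cens_time (\<lambda>j t. S j t \<omega>) x 1 \<partial>M) *
             ennreal (inverse (1 - sin (\<beta> * pi) / (\<beta> * pi)))"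
      unfolding E E1 q_def[symmetric] by (simp only: mult_ac)
  qed
qed

end
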